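(* Let $\epsilon>0$ be given, and consider the adaptively regularized inexact augmented Lagrangian method (Method B) described in the context, applied to the convex conic program described there. Suppose that $\{\rho_k\}$ and $\{\eta_k\}$ are chosen as $$\rho_k=\rho_0\alpha^k,\qquad \eta_k=\eta_0\beta^k$$ for some $\rho_0\ge1$, $0<\eta_0\le1$, $\alpha>1$, $0<\beta<1$ such that $\gamma=\alpha\beta<1$. Then the total number of inner iterations of Method B for finding an $\epsilon$-KKT solution of the conic program is at most $$\mathcal T(\epsilon)=\left\lceil\frac{8\alpha^2\sqrt{\hat C\rho_0}}{\alpha-1}\log\frac{2\alpha\hat C\bar D_X}{\eta_0\beta}\right\rceil\max\left\{1,\left\lceil\frac{2(\bar D+\rho_0\eta_0)}{(1-\gamma)\epsilon}\log_\alpha\frac{2\alpha(\bar D+\rho_0\eta_0)}{(1-\gamma)\epsilon}\right\rceil\right\},$$ where $\hat C=C\rho_0+\hat B+L_{\nabla g}\rho_0\eta_0/(1-\gamma)+1$.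
   Context: **Problem.** Consider $$F^*=\min\{F(x):=f(x)+P(x)\;:\; g(x)\preceq_{\mathcal K}0\},$$ where $f,P:\mathbb R^n\to(-\infty,\infty]$ are proper closed convex, $\mathcal K\subseteq\mathbb R^m$ is a closed convex cone, $y\preceq_{\mathcal K}z$ means $z-y\in\mathcal K$, and $g:\mathbb R^n\to\mathbb R^m$ is $\mathcal K$-convex: $g(\alpha x+(1-\alpha)y)\preceq_{\mathcal K}\alpha g(x)+(1-\alpha)g(y)$ for all $x,y\in\mathbb R^n$, $\alpha\in[0,1]$. Let $\mathcal K^*=\{y:\langle y,x\rangle\ge0\ \forall x\in\mathcal K\}$. The Lagrangian dual problem is $d^*=\sup_{\lambda\in\mathcal K^*}\inf_x\{f(x)+P(x)+\langle\lambda,g(x)\rangle\}$. **Standing assumptions.** (a) The proximal operator of $P$ can be evaluated exactly and $\mathrm{dom}(P)$ is compact. (b) The projection onto $\mathcal K$ can be evaluated exactly. (c) $f$ and $g$ are continuously differentiable on an open set $\Omega\supseteq\mathrm{dom}(P)$, and $\nabla f$, $\nabla g$ are Lipschitz on $\Omega$ with constants $L_{\nabla f}$, $L_{\nabla g}$ ($\nabla g$ is the transpose of the Jacobian of $g$). (d) Strong duality holds: primal and dual problems both have optimal solutions and $F^*=d^*$. **Notation.** $\|\cdot\|$ is the Euclidean norm, $\Pi_C$ the projection onto a closed convex set $C$, $\mathrm{dist}$ the Euclidean distance, $\mathcal N_C$ the normal cone of $C$, $\mathrm{prox}_h(z)=\arg\min_x\{\frac12\|x-z\|^2+h(x)\}$,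 $\log$ the natural logarithm. For $\rho>0$, $$\mathcal S(x,\lambda;\rho)=f(x)+\tfrac1{2\rho}\mathrm{dist}^2(\lambda+\rho g(x),-\mathcal K),\qquad \mathcal L(x,\lambda;\rho)=\mathcal S(x,\lambda;\rho)+P(x)-\tfrac{\|\lambda\|^2}{2\rho}.$$ $L_g$ is the Lipschitz constant of $g$ on $\mathrm{dom}(P)$ and $M_g=\max_{x\in\mathrm{dom}(P)}\|g(x)\|$. $X^*$ and $\Lambda^*$ are the sets of optimal solutions of the primal and dual problems, $\hat\lambda^*\in\Lambda^*$ satisfies $\|\lambda^0-\hat\lambda^*\|=\mathrm{dist}(\lambda^0,\Lambda^* )$, and $$D_X=\max_{x,y\in\mathrm{dom}(P)}\|x-y\|,\quad \bar D_X=\max\{D_X,1\},\quad D_\Lambda=\|\lambda^0-\hat\lambda^*\|,\quad D=\mathrm{dist}(x^0,X^* )+D_\Lambda,\quad \bar D=\max\{D,1\},$$ $$\hat B=L_{\nabla f}+L_{\nabla g}\|\hat\lambda^*\|+L_{\nabla g}D,\qquad C=L_{\nabla g}M_g+L_g^2.$$ **$\epsilon$-KKT solution.** $(x,\lambda)$ is an $\epsilon$-KKT solution if $x\in\mathrm{dom}(P)$, $\lambda\in\mathcal K^*$, $\mathrm{dist}(0,\nabla f(x)+\partial P(x)+\nabla g(x)\lambda)\le\epsilon$ and $\mathrm{dist}(g(x),\mathcal N_{\mathcal K^*}(\lambda))\le\epsilon$. **Inner method** for $\min_x\{\phi(x)+h(x)\}$, with $\phi$ strongly convex with modulus $\mu$,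 $\nabla\phi$ Lipschitz with constant $L_{\nabla\phi}$ on $\mathrm{dom}(h)$, $0<\mu<L_{\nabla\phi}$: take $x^{-1}\in\mathrm{dom}(h)$, set $x^0=\mathrm{prox}_{h/L_{\nabla\phi}}(x^{-1}-\nabla\phi(x^{-1})/L_{\nabla\phi})$, $z^0=x^0$, $a=\sqrt{\mu/L_{\nabla\phi}}$; for $j=0,1,\dots$ set $y^j=(x^j+az^j)/(1+a)$, $z^{j+1}=\arg\min_z\{\phi(y^j)+\langle\nabla\phi(y^j),z-y^j\rangle+h(z)+\frac{aL_{\nabla\phi}}2\|z-ay^j-(1-a)z^j\|^2\}$, $x^{j+1}=(1-a)x^j+az^{j+1}$. With $\tilde x^j=\mathrm{prox}_{h/L_{\nabla\phi}}(x^j-\nabla\phi(x^j)/L_{\nabla\phi})$, the method with tolerance $\eta$ stops as soon as $2L_{\nabla\phi}\|\tilde x^j-x^j\|\le\eta$ and returns $\tilde x^j$ (which satisfies $\mathrm{dist}(0,\partial(\phi+h)(\tilde x^j))\le\eta$). **Method B.** Input $\epsilon>0$, $(x^0,\lambda^0)\in\mathrm{dom}(P)\times\mathcal K^*$, nondecreasing $\{\rho_k\}\subset(0,\infty)$, and $0<\eta_k\downarrow0$. Set $k=0$. 1. Apply the inner method to $\min_x\varphi_k(x)$, where $\varphi_k(x)=\mathcal L(x,\lambda^k;\rho_k)+\frac1{2\rho_k}\|x-x^k\|^2$, to find $x^{k+1}\in\mathrm{dom}(P)$ with $\mathrm{dist}(0,\partial\varphi_k(x^{k+1}))\le\eta_k$.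 Here (up to an additive constant) $\phi=\mathcal S(\cdot,\lambda^k;\rho_k)+\frac1{2\rho_k}\|\cdot-x^k\|^2$, $h=P$, $\mu=1/\rho_k$, $L_{\nabla\phi}=L_{\nabla f}+L_{\nabla g}(\|\lambda^k\|+\rho_kM_g)+\rho_kL_g^2+\rho_k^{-1}$, tolerance $\eta_k$. 2. Set $\lambda^{k+1}=\Pi_{\mathcal K^*}(\lambda^k+\rho_kg(x^{k+1}))$. 3. If $(x^{k+1},\lambda^{k+1})$ is an $\epsilon$-KKT solution, or if both $\frac1{\rho_k}\|(x^{k+1},\lambda^{k+1})-(x^k,\lambda^k)\|\le\frac\epsilon2$ and $\eta_k\le\frac\epsilon2$ hold, output $(x^+,\lambda^+)=(x^{k+1},\lambda^{k+1})$ and terminate. 4. Set $k\leftarrow k+1$ and go to Step 1. The inner iterations of Method B are all the iterations of the inner method performed in Step 1 over all $k$. *)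

theory Defs
  imports "HOL-Analysis.Analysis"
begin

section \<open>Extended-real-valued convex analysis\<close>

definition edom :: "('a \<Rightarrow> ereal) \<Rightarrow> 'a set" where
  "edom h = {x. h x < \<infinity>}"

definition epi :: "('a \<Rightarrow> ereal) \<Rightarrow> ('a \<times> real) set" where
  "epi h = {(x, r). h x \<le> ereal r}"

definition proper_closed_convex :: "('a::euclidean_space \<Rightarrow> ereal) \<Rightarrow> bool" where
  "proper_closed_convex h \<longleftrightarrow>
     (\<forall>x. h x \<noteq> -\<infinity>) \<and> (\<exists>x. h x \<noteq> \<infinity>) \<and> closed (epi h) \<and> convex (epi h)"

text \<open>For proper \<open>h\<close> the following set is empty at every \<open>x\<close> outside the domain of \<open>h\<close>.\<close>

definition subdifferential :: "('a::euclidean_space \<Rightarrow> ereal) \<Rightarrow> 'a \<Rightarrow> 'a set" where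
  "subdifferential h x = {v. \<forall>y. h x + ereal (v \<bullet> (y - x)) \<le> h y}"

definition normal_cone :: "'a::euclidean_space set \<Rightarrow> 'a \<Rightarrow> 'a set" where
  "normal_cone S x = (if x \<in> S then {v. \<forall>y\<in>S. v \<bullet> (y - x) \<le> 0} else {})"

definition dual_cone :: "'a::euclidean_space set \<Rightarrow> 'a set" where
  "dual_cone K = {y. \<forall>x\<in>K. 0 \<le> y \<bullet> x}"

definition cone_le :: "'a::euclidean_space set \<Rightarrow> 'a \<Rightarrow> 'a \<Rightarrow> bool" where
  "cone_le K y z \<longleftrightarrow> z - y \<in> K"

definition cone_convex :: "'b::euclidean_space set \<Rightarrow> ('a::euclidean_space \<Rightarrow> 'b) \<Rightarrow> bool" where
  "cone_convex K g \<longleftrightarrow>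
     (\<forall>x y. \<forall>t\<in>{0..1}. cone_le K (g (t *\<^sub>R x + (1 - t) *\<^sub>R y)) (t *\<^sub>R g x + (1 - t) *\<^sub>R g y))"

text \<open>Unlike \<^const>\<open>infdist\<close>, which is \<open>0\<close> on the empty set, this distance to the empty set is
  \<open>\<infinity>\<close>; this matters because subdifferentials and normal cones can be empty.\<close>

definition edist_set :: "'a::metric_space \<Rightarrow> 'a set \<Rightarrow> ereal" where
  "edist_set x A = (INF a\<in>A. ereal (dist x a))"

definition prox :: "('a::euclidean_space \<Rightarrow> ereal) \<Rightarrow> 'a \<Rightarrow> 'a" where
  "prox h z = (ARG_MIN (\<lambda>x. ereal ((norm (x - z))\<^sup>2 / 2) + h x) x. True)"

text \<open>The gradient is only meaningful at points near which \<open>h\<close> is finite.\<close>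

definition grad :: "('a::euclidean_space \<Rightarrow> ereal) \<Rightarrow> 'a \<Rightarrow> 'a" where
  "grad h x = (THE D. GDERIV (\<lambda>y. real_of_ereal (h y)) x :> D)"

text \<open>The transposed Jacobian, as a bounded linear map, so that its norm is the operator norm.\<close>

definition grad_map ::
  "('a::euclidean_space \<Rightarrow> 'b::euclidean_space) \<Rightarrow> 'a \<Rightarrow> 'b \<Rightarrow>\<^sub>L 'a" where
  "grad_map g x = Blinfun (adjoint (frechet_derivative g (at x)))"


section \<open>The conic program and its Lagrangian dual\<close>

definition feasible :: "('a::euclidean_space \<Rightarrow> 'b::euclidean_space) \<Rightarrow> 'b set \<Rightarrow> 'a set" where
  "feasible g K = {x. cone_le K (g x) 0}"

definition primal_value ::
  "('a::euclidean_space \<Rightarrow> ereal) \<Rightarrow> ('a \<Rightarrow> ereal) \<Rightarrow> ('a \<Rightarrow> 'b::euclidean_space) \<Rightarrow> 'b set \<Rightarrow> ereal"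
  where "primal_value f P g K = (INF x\<in>feasible g K. f x + P x)"

definition primal_solutions ::
  "('a::euclidean_space \<Rightarrow> ereal) \<Rightarrow> ('a \<Rightarrow> ereal) \<Rightarrow> ('a \<Rightarrow> 'b::euclidean_space) \<Rightarrow> 'b set \<Rightarrow> 'a set"
  where "primal_solutions f P g K = {x \<in> feasible g K. f x + P x = primal_value f P g K}"

definition dual_function ::
  "('a::euclidean_space \<Rightarrow> ereal) \<Rightarrow> ('a \<Rightarrow> ereal) \<Rightarrow> ('a \<Rightarrow> 'b::euclidean_space) \<Rightarrow> 'b \<Rightarrow> ereal"
  where "dual_function f P g lam = (INF x. f x + P x + ereal (lam \<bullet> g x))"

definition dual_value ::
  "('a::euclidean_space \<Rightarrow> ereal) \<Rightarrow> ('a \<Rightarrow> ereal) \<Rightarrow> ('a \<Rightarrow> 'b::euclidean_space) \<Rightarrow> 'b set \<Rightarrow> ereal"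
  where "dual_value f P g K = (SUP lam\<in>dual_cone K. dual_function f P g lam)"

definition dual_solutions ::
  "('a::euclidean_space \<Rightarrow> ereal) \<Rightarrow> ('a \<Rightarrow> ereal) \<Rightarrow> ('a \<Rightarrow> 'b::euclidean_space) \<Rightarrow> 'b set \<Rightarrow> 'b set"
  where "dual_solutions f P g K =
    {lam \<in> dual_cone K. dual_function f P g lam = dual_value f P g K}"

definition eps_KKT ::
  "('a::euclidean_space \<Rightarrow> ereal) \<Rightarrow> ('a \<Rightarrow> ereal) \<Rightarrow> ('a \<Rightarrow> 'b::euclidean_space) \<Rightarrow> 'b set \<Rightarrow>
   real \<Rightarrow> 'a \<times> 'b \<Rightarrow> bool" where
  "eps_KKT f P g K \<epsilon> = (\<lambda>(x, lam).
     x \<in> edom P \<and> lam \<in> dual_cone K \<and>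
     edist_set 0 {grad f x + v + blinfun_apply (grad_map g x) lam | v. v \<in> subdifferential P x}
       \<le> ereal \<epsilon> \<and>
     edist_set (g x) (normal_cone (dual_cone K) lam) \<le> ereal \<epsilon>)"


section \<open>The accelerated inner method\<close>

definition prox_grad_step ::
  "('a::euclidean_space \<Rightarrow> ereal) \<Rightarrow> ('a \<Rightarrow> ereal) \<Rightarrow> real \<Rightarrow> 'a \<Rightarrow> 'a" where
  "prox_grad_step \<phi> h L x = prox (\<lambda>u. h u / ereal L) (x - (1 / L) *\<^sub>R grad \<phi> x)"

text \<open>The pair \<open>(x\<^sup>j, z\<^sup>j)\<close>; the argument \<open>xm\<close> is the starting point \<open>x\<^sup>-\<^sup>1\<close>.\<close>

primrec inner_seq ::
  "('a::euclidean_space \<Rightarrow> ereal) \<Rightarrow> ('a \<Rightarrow> ereal) \<Rightarrow> real \<Rightarrow> real \<Rightarrow> 'a \<Rightarrow> nat \<Rightarrow> 'a \<times> 'a" where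
  "inner_seq \<phi> h \<mu> L xm 0 = (prox_grad_step \<phi> h L xm, prox_grad_step \<phi> h L xm)"
| "inner_seq \<phi> h \<mu> L xm (Suc j) =
     (let (x, z) = inner_seq \<phi> h \<mu> L xm j;
          a = sqrt (\<mu> / L);
          y = (1 / (1 + a)) *\<^sub>R (x + a *\<^sub>R z);
          z' = (ARG_MIN (\<lambda>u. \<phi> y + ereal (grad \<phi> y \<bullet> (u - y)) + h u
                   + ereal (a * L / 2 * (norm (u - a *\<^sub>R y - (1 - a) *\<^sub>R z))\<^sup>2)) u. True)
      in ((1 - a) *\<^sub>R x + a *\<^sub>R z', z'))"

definition inner_test ::
  "('a::euclidean_space \<Rightarrow> ereal) \<Rightarrow> ('a \<Rightarrow> ereal) \<Rightarrow> real \<Rightarrow> real \<Rightarrow> 'a \<Rightarrow> real \<Rightarrow> nat \<Rightarrow> bool" where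
  "inner_test \<phi> h \<mu> L xm tol j \<longleftrightarrow>
     (let x = fst (inner_seq \<phi> h \<mu> L xm j) in 2 * L * norm (prox_grad_step \<phi> h L x - x) \<le> tol)"

text \<open>The next three constants describe a run of the inner method. The index and the result are only
  meaningful if the run terminates. The last pass, in which the stopping test succeeds, is
  counted as an iteration, so a run that stops at index \<open>j\<close> has \<open>j + 1\<close> iterations.\<close>

definition inner_terminates ::
  "('a::euclidean_space \<Rightarrow> ereal) \<Rightarrow> ('a \<Rightarrow> ereal) \<Rightarrow> real \<Rightarrow> real \<Rightarrow> 'a \<Rightarrow> real \<Rightarrow> bool" where
  "inner_terminates \<phi> h \<mu> L xm tol \<longleftrightarrow> (\<exists>j. inner_test \<phi> h \<mu> L xm tol j)"

definition inner_iterations ::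
  "('a::euclidean_space \<Rightarrow> ereal) \<Rightarrow> ('a \<Rightarrow> ereal) \<Rightarrow> real \<Rightarrow> real \<Rightarrow> 'a \<Rightarrow> real \<Rightarrow> nat" where
  "inner_iterations \<phi> h \<mu> L xm tol = (LEAST j. inner_test \<phi> h \<mu> L xm tol j) + 1"

definition inner_result ::
  "('a::euclidean_space \<Rightarrow> ereal) \<Rightarrow> ('a \<Rightarrow> ereal) \<Rightarrow> real \<Rightarrow> real \<Rightarrow> 'a \<Rightarrow> real \<Rightarrow> 'a" where
  "inner_result \<phi> h \<mu> L xm tol =
     prox_grad_step \<phi> h L (fst (inner_seq \<phi> h \<mu> L xm (LEAST j. inner_test \<phi> h \<mu> L xm tol j)))"


section \<open>The regularized augmented Lagrangian method\<close>

text \<open>\<open>-\<K>\<close> is nonempty, so \<^const>\<open>infdist\<close> is the usual distance here.\<close>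

definition smooth_part ::
  "('a::euclidean_space \<Rightarrow> ereal) \<Rightarrow> ('a \<Rightarrow> 'b::euclidean_space) \<Rightarrow> 'b set \<Rightarrow> 'a \<Rightarrow> 'b \<Rightarrow> real \<Rightarrow> ereal"
  where "smooth_part f g K x lam \<rho> =
    f x + ereal (1 / (2 * \<rho>) * (infdist (lam + \<rho> *\<^sub>R g x) (uminus ` K))\<^sup>2)"

text \<open>The \<open>k\<close>-th subproblem minimizes the augmented Lagrangian \<open>smooth_part + P - \<parallel>lam\<parallel>\<^sup>2 / (2 * \<rho>)\<close>
  plus a proximal term centred at \<open>xc\<close>. Its smooth component, without the additive constant, is:\<close>

definition sub_phi ::
  "('a::euclidean_space \<Rightarrow> ereal) \<Rightarrow> ('a \<Rightarrow> 'b::euclidean_space) \<Rightarrow> 'b set \<Rightarrow> 'a \<times> 'b \<Rightarrow> real \<Rightarrow>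
   'a \<Rightarrow> ereal" where
  "sub_phi f g K = (\<lambda>(xc, lam) \<rho> x.
     smooth_part f g K x lam \<rho> + ereal (1 / (2 * \<rho>) * (norm (x - xc))\<^sup>2))"

text \<open>A Lipschitz constant of the gradient of \<^const>\<open>sub_phi\<close>. Here \<open>Lf\<close> and \<open>LG\<close> are Lipschitz
  constants of the gradient of \<open>f\<close> and of \<^const>\<open>grad_map\<close> \<open>g\<close>, \<open>Lg\<close> is one of \<open>g\<close> on the domain
  of \<open>P\<close>, and \<open>Mg\<close> is the maximum of the norm of \<open>g\<close> there.\<close>

definition sub_L :: "real \<Rightarrow> real \<Rightarrow> real \<Rightarrow> real \<Rightarrow> 'b::euclidean_space \<Rightarrow> real \<Rightarrow> real" where
  "sub_L Lf LG Lg Mg lam \<rho> = Lf + LG * (norm lam + \<rho> * Mg) + \<rho> * Lg\<^sup>2 + 1 / \<rho>"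

text \<open>The iterates \<open>(x\<^sup>k, lam\<^sup>k)\<close>, continued regardless of the outer stopping test; \<open>xm k\<close> is the
  starting point chosen for the inner method in the \<open>k\<close>-th outer iteration.\<close>

primrec outer_seq ::
  "('a::euclidean_space \<Rightarrow> ereal) \<Rightarrow> ('a \<Rightarrow> ereal) \<Rightarrow> ('a \<Rightarrow> 'b::euclidean_space) \<Rightarrow> 'b set \<Rightarrow>
   ('b \<Rightarrow> real \<Rightarrow> real) \<Rightarrow> (nat \<Rightarrow> real) \<Rightarrow> (nat \<Rightarrow> real) \<Rightarrow> (nat \<Rightarrow> 'a) \<Rightarrow> 'a \<times> 'b \<Rightarrow> nat \<Rightarrow> 'a \<times> 'b"
  where
  "outer_seq f P g K L \<rho> \<eta> xm w0 0 = w0"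
| "outer_seq f P g K L \<rho> \<eta> xm w0 (Suc k) =
     (let w = outer_seq f P g K L \<rho> \<eta> xm w0 k;
          x' = inner_result (sub_phi f g K w (\<rho> k)) P (1 / \<rho> k) (L (snd w) (\<rho> k)) (xm k) (\<eta> k)
      in (x', closest_point (dual_cone K) (snd w + \<rho> k *\<^sub>R g x')))"

definition outer_inner_terminates ::
  "('a::euclidean_space \<Rightarrow> ereal) \<Rightarrow> ('a \<Rightarrow> ereal) \<Rightarrow> ('a \<Rightarrow> 'b::euclidean_space) \<Rightarrow> 'b set \<Rightarrow>
   ('b \<Rightarrow> real \<Rightarrow> real) \<Rightarrow> (nat \<Rightarrow> real) \<Rightarrow> (nat \<Rightarrow> real) \<Rightarrow> (nat \<Rightarrow> 'a) \<Rightarrow> 'a \<times> 'b \<Rightarrow> nat \<Rightarrow> bool"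
  where
  "outer_inner_terminates f P g K L \<rho> \<eta> xm w0 k \<longleftrightarrow>
     (let w = outer_seq f P g K L \<rho> \<eta> xm w0 k
      in inner_terminates (sub_phi f g K w (\<rho> k)) P (1 / \<rho> k) (L (snd w) (\<rho> k)) (xm k) (\<eta> k))"

definition outer_inner_iterations ::
  "('a::euclidean_space \<Rightarrow> ereal) \<Rightarrow> ('a \<Rightarrow> ereal) \<Rightarrow> ('a \<Rightarrow> 'b::euclidean_space) \<Rightarrow> 'b set \<Rightarrow>
   ('b \<Rightarrow> real \<Rightarrow> real) \<Rightarrow> (nat \<Rightarrow> real) \<Rightarrow> (nat \<Rightarrow> real) \<Rightarrow> (nat \<Rightarrow> 'a) \<Rightarrow> 'a \<times> 'b \<Rightarrow> nat \<Rightarrow> nat"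
  where
  "outer_inner_iterations f P g K L \<rho> \<eta> xm w0 k =
     (let w = outer_seq f P g K L \<rho> \<eta> xm w0 k
      in inner_iterations (sub_phi f g K w (\<rho> k)) P (1 / \<rho> k) (L (snd w) (\<rho> k)) (xm k) (\<eta> k))"

definition outer_test ::
  "('a::euclidean_space \<Rightarrow> ereal) \<Rightarrow> ('a \<Rightarrow> ereal) \<Rightarrow> ('a \<Rightarrow> 'b::euclidean_space) \<Rightarrow> 'b set \<Rightarrow>
   ('b \<Rightarrow> real \<Rightarrow> real) \<Rightarrow> (nat \<Rightarrow> real) \<Rightarrow> (nat \<Rightarrow> real) \<Rightarrow> (nat \<Rightarrow> 'a) \<Rightarrow> 'a \<times> 'b \<Rightarrow> real \<Rightarrow> nat \<Rightarrow> bool"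
  where
  "outer_test f P g K L \<rho> \<eta> xm w0 \<epsilon> k \<longleftrightarrow>
     (let w = outer_seq f P g K L \<rho> \<eta> xm w0 k;
          w' = outer_seq f P g K L \<rho> \<eta> xm w0 (Suc k)
      in eps_KKT f P g K \<epsilon> w' \<or> (1 / \<rho> k * norm (w' - w) \<le> \<epsilon> / 2 \<and> \<eta> k \<le> \<epsilon> / 2))"

text \<open>The method terminates in its outer iteration \<open>N\<close>, after all calls of the inner method
  up to then have terminated. Its output is then the iterate with index \<open>Suc N\<close>.\<close>

definition outer_terminates_at ::
  "('a::euclidean_space \<Rightarrow> ereal) \<Rightarrow> ('a \<Rightarrow> ereal) \<Rightarrow> ('a \<Rightarrow> 'b::euclidean_space) \<Rightarrow> 'b set \<Rightarrow>
   ('b \<Rightarrow> real \<Rightarrow> real) \<Rightarrow> (nat \<Rightarrow> real) \<Rightarrow> (nat \<Rightarrow> real) \<Rightarrow> (nat \<Rightarrow> 'a) \<Rightarrow> 'a \<times> 'b \<Rightarrow> real \<Rightarrow> nat \<Rightarrow> bool"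
  where
  "outer_terminates_at f P g K L \<rho> \<eta> xm w0 \<epsilon> N \<longleftrightarrow>
     (\<forall>k\<le>N. outer_inner_terminates f P g K L \<rho> \<eta> xm w0 k) \<and>
     outer_test f P g K L \<rho> \<eta> xm w0 \<epsilon> N \<and>
     (\<forall>k<N. \<not> outer_test f P g K L \<rho> \<eta> xm w0 \<epsilon> k)"

end

theory Submission
  imports Defs
begin

text \<open>
  One outer iteration is an inexact step of the proximal point algorithm for the saddle operator of
  the Lagrangian, with proximal parameter \<open>\<rho> k\<close> and error \<open>\<rho> k * \<eta> k\<close>. A primal and a dual solution form
  a saddle point, that is, a zero of this operator, so the distance to it grows by at most the error
  and the displacement of the step is at most that distance plus the error
  (\<open>inexact_proximal_point\<close>, \<open>outer_step_obtuse\<close>, \<open>outer_distances\<close>). The errors form a geometric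
  series with ratio \<open>\<gamma> < 1\<close>. Hence the iterates stay bounded, and the displacements divided by
  \<open>\<rho> k\<close> decay like the inverse powers of \<open>\<alpha>\<close>; the stopping test holds after about
  \<open>log \<alpha> (D_bar / \<epsilon>)\<close> outer iterations. A short displacement and a small residual of the subproblem
  together give an approximate KKT point (\<open>eps_KKT_if_short_step\<close>).

  The smooth part of a subproblem is strongly convex with modulus \<open>1 / \<rho> k\<close>. The Lipschitz
  constant of its gradient is at most \<open>C_hat * \<alpha> ^ k\<close>, because the multipliers are bounded. The
  accelerated method contracts the sum of the optimality gap and a multiple of a squared distance by
  the factor \<open>1 - sqrt (\<mu> / L)\<close> (\<open>accelerated_step\<close>), so one inner run costs a multiple of
  \<open>sqrt (L / \<mu>) \<le> sqrt (C_hat * \<rho>0) * \<alpha> ^ k\<close> times a logarithm that is affine in \<open>k\<close>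
  (\<open>inner_method_complexity\<close>). The last outer iteration dominates the geometric sum of these costs
  (\<open>sum_iterations_le\<close>).

  The domain of \<open>P\<close> may have empty interior. The Lipschitz constant of \<open>g\<close> on it then bounds the
  Jacobian of \<open>g\<close> only in the directions of its affine hull (\<open>Dg_bound\<close>). This suffices: the
  descent inequality compares points of the domain, and the part of a gradient that is orthogonal to
  all these directions can be moved into the subdifferential of \<open>P\<close> (\<open>inner_method_result\<close>).
\<close>

section \<open>Convex functions with extended real values\<close>

lemma proper_finite_on_edom:
  assumes "proper_closed_convex h" "x \<in> edom h"
  shows "ereal (real_of_ereal (h x)) = h x"
  using assms unfolding proper_closed_convex_def edom_def
  by (cases "h x") auto

lemma proper_outside_edom:
  assumes "x \<notin> edom h"
  shows "h x = \<infinity>"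
  using assms unfolding edom_def by auto

lemma edom_nonempty:
  assumes "proper_closed_convex h"
  shows "edom h \<noteq> {}"
  using assms unfolding proper_closed_convex_def edom_def by fastforce

lemma proper_convexD:
  assumes h: "proper_closed_convex h" and x: "x \<in> edom h" and y: "y \<in> edom h"
    and s: "0 \<le> s" "s \<le> 1"
  shows "(1 - s) *\<^sub>R x + s *\<^sub>R y \<in> edom h"
    and "real_of_ereal (h ((1 - s) *\<^sub>R x + s *\<^sub>R y))
      \<le> (1 - s) * real_of_ereal (h x) + s * real_of_ereal (h y)"
proof -
  have "(x, real_of_ereal (h x)) \<in> epi h" "(y, real_of_ereal (h y)) \<in> epi h"
    using proper_finite_on_edom[OF h] x y by (auto simp: epi_def)
  then have "(1 - s) *\<^sub>R (x, real_of_ereal (h x)) + s *\<^sub>R (y, real_of_ereal (h y)) \<in> epi h"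
    using h s unfolding proper_closed_convex_def by (intro convexD) auto
  then have le: "h ((1 - s) *\<^sub>R x + s *\<^sub>R y)
      \<le> ereal ((1 - s) * real_of_ereal (h x) + s * real_of_ereal (h y))"
    by (simp add: epi_def)
  then show dom: "(1 - s) *\<^sub>R x + s *\<^sub>R y \<in> edom h"
    unfolding edom_def by (auto intro: le_less_trans)
  show "real_of_ereal (h ((1 - s) *\<^sub>R x + s *\<^sub>R y))
      \<le> (1 - s) * real_of_ereal (h x) + s * real_of_ereal (h y)"
    using le proper_finite_on_edom[OF h dom] by (metis ereal_less_eq(3))
qed

lemma convex_edom:
  assumes "proper_closed_convex h"
  shows "convex (edom h)"
  using proper_convexD(1)[OF assms] by (auto simp: convex_alt)

lemma subdifferentialI_edom:
  assumes h: "proper_closed_convex h" and p: "p \<in> edom h"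
    and sub: "\<And>u. u \<in> edom h \<Longrightarrow> real_of_ereal (h p) + v \<bullet> (u - p) \<le> real_of_ereal (h u)"
  shows "v \<in> subdifferential h p"
  unfolding subdifferential_def
proof safe
  fix u
  show "h p + ereal (v \<bullet> (u - p)) \<le> h u"
  proof (cases "u \<in> edom h")
    case True
    then show ?thesis
      using sub[OF True] proper_finite_on_edom[OF h p] proper_finite_on_edom[OF h True]
      by (metis ereal_less_eq(3) plus_ereal.simps(1))
  qed (simp add: proper_outside_edom)
qed

lemma subdifferentialD_edom:
  assumes h: "proper_closed_convex h" and p: "p \<in> edom h" and u: "u \<in> edom h"
    and v: "v \<in> subdifferential h p"
  shows "real_of_ereal (h p) + v \<bullet> (u - p) \<le> real_of_ereal (h u)"
proof -
  have "h p + ereal (v \<bullet> (u - p)) \<le> h u"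
    using v unfolding subdifferential_def by auto
  then show ?thesis
    using proper_finite_on_edom[OF h p] proper_finite_on_edom[OF h u]
    by (metis ereal_less_eq(3) plus_ereal.simps(1))
qed

text \<open>The difference quotients of a function that is convex along a segment lie below the slope
  of the chord, so their limit does too.\<close>

lemma convex_on_segment_derivative_le:
  fixes F :: "'a::real_normed_vector \<Rightarrow> real"
  assumes D: "(F has_derivative F') (at x)"
    and cvx: "\<And>s. 0 < s \<Longrightarrow> s \<le> 1 \<Longrightarrow> F ((1 - s) *\<^sub>R x + s *\<^sub>R y) \<le> (1 - s) * F x + s * F y"
  shows "F' (y - x) \<le> F y - F x"
proof -
  interpret F': bounded_linear F' using D by (rule has_derivative_bounded_linear)
  have "((\<lambda>s. x + s *\<^sub>R (y - x)) has_derivative (\<lambda>s. s *\<^sub>R (y - x))) (at 0)"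
    by (auto intro!: derivative_eq_intros)
  then have "((\<lambda>s. F (x + s *\<^sub>R (y - x))) has_derivative (\<lambda>s. F' (s *\<^sub>R (y - x)))) (at 0)"
    by (rule has_derivative_compose) (use D in simp)
  then have "((\<lambda>s. F (x + s *\<^sub>R (y - x))) has_real_derivative F' (y - x)) (at 0)"
    by (simp add: has_field_derivative_def F'.scaleR mult_commute_abs)
  then have "((\<lambda>s. (F (x + s *\<^sub>R (y - x)) - F x) / s) \<longlongrightarrow> F' (y - x)) (at 0)"
    by (simp add: DERIV_def)
  then have lim: "((\<lambda>s. (F (x + s *\<^sub>R (y - x)) - F x) / s) \<longlongrightarrow> F' (y - x)) (at_right 0)"
    by (rule filterlim_mono) (auto simp: at_le)
  have "eventually (\<lambda>s. (F (x + s *\<^sub>R (y - x)) - F x) / s \<le> F y - F x) (at_right 0)"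
    unfolding eventually_at_right_field
  proof (intro exI[of _ 1] conjI allI impI)
    fix s :: real assume s: "0 < s" "s < 1"
    have "x + s *\<^sub>R (y - x) = (1 - s) *\<^sub>R x + s *\<^sub>R y" by (simp add: algebra_simps)
    then have "F (x + s *\<^sub>R (y - x)) - F x \<le> s * (F y - F x)"
      using cvx[of s] s by (simp add: algebra_simps)
    then show "(F (x + s *\<^sub>R (y - x)) - F x) / s \<le> F y - F x"
      using s by (simp add: field_simps)
  qed simp
  then show ?thesis
    by (rule tendsto_upperbound[OF lim]) simp
qed

section \<open>Minimizers of proximal models\<close>

text \<open>The closed sublevel sets of the model form a chain of nonempty compact sets, so they have a
  common point.\<close>

lemma closed_function_attains_min:
  fixes h :: "'a::euclidean_space \<Rightarrow> ereal"
  assumes h: "proper_closed_convex h" and comp: "compact (edom h)"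
    and q: "continuous_on UNIV q"
  shows "\<exists>p\<in>edom h. \<forall>u\<in>edom h. q p + real_of_ereal (h p) \<le> q u + real_of_ereal (h u)"
proof -
  let ?Q = "\<lambda>u. q u + real_of_ereal (h u)"
  define S where "S u = {x. h x \<le> ereal (?Q u - q x)}" for u
  have S_iff: "x \<in> S u \<longleftrightarrow> x \<in> edom h \<and> ?Q x \<le> ?Q u" for x u
  proof (cases "x \<in> edom h")
    case True
    then have "h x = ereal (real_of_ereal (h x))" using proper_finite_on_edom[OF h] by simp
    then have "h x \<le> ereal (?Q u - q x) \<longleftrightarrow> real_of_ereal (h x) \<le> ?Q u - q x"
      by (metis ereal_less_eq(3))
    then show ?thesis using True by (auto simp: S_def)
  qed (auto simp: S_def proper_outside_edom)
  have "closed (S u)" for u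
  proof -
    have "closed (epi h)" using h by (simp add: proper_closed_convex_def)
    moreover have "continuous_on UNIV (\<lambda>x. (x, ?Q u - q x))"
      by (intro continuous_intros q)
    ultimately have "closed ((\<lambda>x. (x, ?Q u - q x)) -` epi h)"
      using continuous_on_closed_vimage[of UNIV "\<lambda>x. (x, ?Q u - q x)"] by auto
    then show ?thesis by (simp add: epi_def S_def vimage_def)
  qed
  moreover have "edom h \<inter> (\<Inter>u\<in>I. S u) \<noteq> {}" if I: "finite I" "I \<subseteq> edom h" for I
  proof (cases "I = {}")
    case True
    then show ?thesis using edom_nonempty[OF h] by auto
  next
    case False
    then obtain p where p: "p \<in> I" "\<And>u. u \<in> I \<Longrightarrow> ?Q p \<le> ?Q u"
      using arg_min_if_finite(1)[OF I(1) False, of ?Q] arg_min_least[OF I(1) False, of _ ?Q] by blast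
    then have "p \<in> edom h \<inter> (\<Inter>u\<in>I. S u)" using I(2) S_iff by auto
    then show ?thesis by blast
  qed
  ultimately have "edom h \<inter> (\<Inter>u\<in>edom h. S u) \<noteq> {}"
    using compact_imp_fip_image[OF comp, of "edom h" S] by blast
  then show ?thesis using S_iff by blast
qed

text \<open>All the minimizations in the inner method are of this form. What later arguments use about a
  minimizer is only the first order condition: minus the gradient of the quadratic part is a
  subgradient of \<open>h\<close>.\<close>

lemma arg_min_quadratic_model:
  fixes h :: "'a::euclidean_space \<Rightarrow> ereal"
  assumes h: "proper_closed_convex h" and comp: "compact (edom h)"
    and \<kappa>: "0 \<le> \<kappa>" and k: "0 < k"
    and F: "\<And>u. u \<in> edom h \<Longrightarrow>
      F u = ereal (k * (c \<bullet> u + \<kappa> / 2 * (norm (u - v))\<^sup>2 + real_of_ereal (h u)) + b)"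
    and F_out: "\<And>u. u \<notin> edom h \<Longrightarrow> F u = \<infinity>"
    and p: "p = (ARG_MIN F u. True)"
  shows "p \<in> edom h"
    and "\<And>u. u \<in> edom h \<Longrightarrow>
      real_of_ereal (h p) - (c + \<kappa> *\<^sub>R (p - v)) \<bullet> (u - p) \<le> real_of_ereal (h u)"
proof -
  let ?h = "\<lambda>u. real_of_ereal (h u)"
  define q where "q u = c \<bullet> u + \<kappa> / 2 * (norm (u - v))\<^sup>2" for u
  have "continuous_on UNIV q"
    unfolding q_def by (intro continuous_intros)
  then obtain p' where p': "p' \<in> edom h" "\<And>u. u \<in> edom h \<Longrightarrow> q p' + ?h p' \<le> q u + ?h u"
    using closed_function_attains_min[OF h comp] by blast
  have F_q: "F u = ereal (k * (q u + ?h u) + b)" if "u \<in> edom h" for u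
    using F[OF that] by (simp add: q_def)
  have "F p' \<le> F u" for u
  proof (cases "u \<in> edom h")
    case True
    then show ?thesis using p' k F_q by (simp add: mult_left_mono)
  qed (simp add: F_out)
  then have min: "F p \<le> F u" for u
    unfolding p using arg_minI[of "\<lambda>_. True" p' F "\<lambda>p. \<forall>u. F p \<le> F u"] by (auto simp: not_less)
  show dom: "p \<in> edom h"
    using min[of p'] F_out[of p] F_q[OF p'(1)] by (cases "p \<in> edom h") auto
  fix u assume u: "u \<in> edom h"
  have minq: "q p + ?h p \<le> q y + ?h y" if "y \<in> edom h" for y
    using min[of y] k F_q[OF that] F_q[OF dom] by simp
  have key: "- (?h u - ?h p) \<le> (c + \<kappa> *\<^sub>R (p - v)) \<bullet> (u - p) + \<kappa> / 2 * s * (norm (u - p))\<^sup>2"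
    if s: "0 < s" "s < 1" for s
  proof -
    let ?y = "(1 - s) *\<^sub>R p + s *\<^sub>R u"
    have y: "?y \<in> edom h" "?h ?y \<le> (1 - s) * ?h p + s * ?h u"
      using proper_convexD[OF h dom u] s by auto
    have "q ?y = q p + s * ((c + \<kappa> *\<^sub>R (p - v)) \<bullet> (u - p)) + \<kappa> / 2 * s\<^sup>2 * (norm (u - p))\<^sup>2"
    proof -
      have "norm (?y - v) ^ 2 = norm ((p - v) + s *\<^sub>R (u - p)) ^ 2"
        by (simp add: algebra_simps)
      also have "\<dots> = (norm (p - v))\<^sup>2 + 2 * s * ((p - v) \<bullet> (u - p)) + s\<^sup>2 * (norm (u - p))\<^sup>2"
        unfolding power2_norm_eq_inner
        by (simp add: inner_add inner_commute power2_eq_square)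
      finally have sq: "norm (?y - v) ^ 2 = \<dots>" .
      have "c \<bullet> ?y = c \<bullet> p + s * (c \<bullet> (u - p))"
        by (simp add: inner_add inner_diff algebra_simps)
      then show ?thesis
        unfolding q_def sq by (simp add: inner_add_left ring_distribs)
    qed
    then have "0 \<le> s * ((c + \<kappa> *\<^sub>R (p - v)) \<bullet> (u - p) + \<kappa> / 2 * s * (norm (u - p))\<^sup>2
        + (?h u - ?h p))"
      using minq[OF y(1)] y(2) by (simp add: algebra_simps power2_eq_square)
    then show ?thesis using s by (simp add: zero_le_mult_iff)
  qed
  let ?m = "(c + \<kappa> *\<^sub>R (p - v)) \<bullet> (u - p)"
  have "((\<lambda>s. ?m + \<kappa> / 2 * s * (norm (u - p))\<^sup>2) \<longlongrightarrow> ?m + \<kappa> / 2 * 0 * (norm (u - p))\<^sup>2) (at_right 0)"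
    by (intro tendsto_intros)
  moreover have "eventually (\<lambda>s. - (?h u - ?h p) \<le> ?m + \<kappa> / 2 * s * (norm (u - p))\<^sup>2) (at_right 0)"
    unfolding eventually_at_right_field using key by (intro exI[of _ 1]) auto
  ultimately have "- (?h u - ?h p) \<le> ?m + \<kappa> / 2 * 0 * (norm (u - p))\<^sup>2"
    by (rule tendsto_lowerbound) simp
  then show "?h p - ?m \<le> ?h u" by simp
qed

section \<open>The accelerated inner method\<close>

text \<open>The linear subspace parallel to the affine hull of \<open>S\<close>.\<close>

definition direction_space :: "'a::real_vector set \<Rightarrow> 'a set" where
  "direction_space S = span {a - b | a b. a \<in> S \<and> b \<in> S}"

lemma diff_in_direction_space: "a \<in> S \<Longrightarrow> b \<in> S \<Longrightarrow> a - b \<in> direction_space S"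
  unfolding direction_space_def by (intro span_base) auto

lemma norm_sq_convex_combination:
  fixes x y v :: "'a::real_inner"
  shows "(norm ((1 - s) *\<^sub>R x + s *\<^sub>R y - v))\<^sup>2
    = (1 - s) * (norm (x - v))\<^sup>2 + s * (norm (y - v))\<^sup>2 - s * (1 - s) * (norm (y - x))\<^sup>2"
  unfolding power2_norm_eq_inner
  by (simp add: inner_simps algebra_simps inner_commute)

lemma norm_sq_three_points:
  fixes u x p :: "'a::real_inner"
  shows "(norm (u - x))\<^sup>2 = (norm (u - p))\<^sup>2 + (norm (p - x))\<^sup>2 + 2 * ((p - x) \<bullet> (u - p))"
  unfolding power2_norm_eq_inner by (simp add: inner_diff inner_commute)

lemma affine_hull_add_direction:
  fixes S :: "'a::real_vector set"
  assumes x: "x \<in> affine hull S" and d: "d \<in> direction_space S"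
  shows "x + d \<in> affine hull S"
  using d unfolding direction_space_def
proof (induction rule: span_induct_alt)
  case base
  then show ?case using x by simp
next
  case (step c v w)
  then obtain p q where "v = p - q" "p \<in> S" "q \<in> S" by auto
  then have "(x + w) + c *\<^sub>R (p - q) \<in> affine hull S"
    using step by (intro mem_affine_3_minus) (auto intro: hull_inc)
  then show ?case using \<open>v = p - q\<close> by (simp add: ac_simps)
qed

text \<open>The gradient is only required to be Lipschitz in the directions of the affine hull of the
  domain. For the conic program this is all that the Lipschitz constant of \<open>g\<close> on the domain
  gives, because the domain may have empty interior.\<close>

locale composite_problem =
  fixes \<phi> h :: "'a::euclidean_space \<Rightarrow> ereal" and \<mu> L :: real
  assumes h: "proper_closed_convex h" and comp: "compact (edom h)"
    and \<mu>: "0 < \<mu>" "\<mu> \<le> L"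
    and \<phi>_finite: "x \<in> edom h \<Longrightarrow> ereal (real_of_ereal (\<phi> x)) = \<phi> x"
    and \<phi>_deriv: "x \<in> edom h \<Longrightarrow> GDERIV (\<lambda>y. real_of_ereal (\<phi> y)) x :> grad \<phi> x"
    and \<phi>_strong: "x \<in> edom h \<Longrightarrow> y \<in> edom h \<Longrightarrow>
      real_of_ereal (\<phi> x) + grad \<phi> x \<bullet> (y - x) + \<mu> / 2 * (norm (y - x))\<^sup>2 \<le> real_of_ereal (\<phi> y)"
    and \<phi>_lipschitz: "x \<in> edom h \<Longrightarrow> y \<in> edom h \<Longrightarrow> d \<in> direction_space (edom h) \<Longrightarrow>
      (grad \<phi> y - grad \<phi> x) \<bullet> d \<le> L * norm (y - x) * norm d"
begin

abbreviation "X \<equiv> edom h"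
abbreviation "hr u \<equiv> real_of_ereal (h u)"
abbreviation "\<phi>r u \<equiv> real_of_ereal (\<phi> u)"
abbreviation "G \<equiv> grad \<phi>"
abbreviation "\<Phi> u \<equiv> \<phi>r u + hr u"
abbreviation "step \<equiv> prox_grad_step \<phi> h L"
definition "a = sqrt (\<mu> / L)"

lemma L_pos: "0 < L" using \<mu> by linarith

lemma a_bounds: "0 < a" "a \<le> 1" and a_sq: "a * a * L = \<mu>"
proof -
  show "0 < a" "a \<le> 1" using \<mu> L_pos by (auto simp: a_def)
  have "a * a = \<mu> / L" unfolding a_def using \<mu> L_pos by (intro real_sqrt_mult_self[THEN trans]) simp
  then show "a * a * L = \<mu>" using L_pos by simp
qed

lemma X_convex: "x \<in> X \<Longrightarrow> y \<in> X \<Longrightarrow> 0 \<le> s \<Longrightarrow> s \<le> 1 \<Longrightarrow> (1 - s) *\<^sub>R x + s *\<^sub>R y \<in> X"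
  using proper_convexD(1)[OF h] by blast

text \<open>Along the segment from \<open>x\<close> to \<open>y\<close>, the derivative of the upper model minus \<open>\<phi>\<close> is
  nonnegative by the Lipschitz bound.\<close>

lemma descent:
  assumes x: "x \<in> X" and y: "y \<in> X"
  shows "\<phi>r y \<le> \<phi>r x + G x \<bullet> (y - x) + L / 2 * (norm (y - x))\<^sup>2"
proof -
  let ?d = "y - x"
  define F where "F t = \<phi>r (x + t *\<^sub>R ?d) - t * (G x \<bullet> ?d) - L / 2 * t\<^sup>2 * (norm ?d)\<^sup>2" for t
  have "F 1 \<le> F 0"
  proof (rule DERIV_nonpos_imp_nonincreasing[of 0 1 F])
    fix t :: real assume t: "0 \<le> t" "t \<le> 1"
    let ?z = "x + t *\<^sub>R ?d"
    have "?z = (1 - t) *\<^sub>R x + t *\<^sub>R y" by (simp add: algebra_simps)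
    then have z: "?z \<in> X" using X_convex[OF x y t] by simp
    have "((\<lambda>t. x + t *\<^sub>R ?d) has_derivative (\<lambda>s. s *\<^sub>R ?d)) (at t)"
      by (auto intro!: derivative_eq_intros)
    then have "((\<lambda>t. \<phi>r (x + t *\<^sub>R ?d)) has_derivative (\<lambda>s. (s *\<^sub>R ?d) \<bullet> G ?z)) (at t)"
      by (rule has_derivative_compose) (use \<phi>_deriv[OF z] in \<open>simp add: gderiv_def\<close>)
    then have D: "((\<lambda>t. \<phi>r (x + t *\<^sub>R ?d)) has_real_derivative (?d \<bullet> G ?z)) (at t)"
      by (simp add: has_field_derivative_def mult_commute_abs)
    have DF: "(F has_real_derivative (?d \<bullet> G ?z - G x \<bullet> ?d - L * t * (norm ?d)\<^sup>2)) (at t)"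
      unfolding F_def by (rule derivative_eq_intros D refl | simp)+
    have "(G ?z - G x) \<bullet> ?d \<le> L * norm (?z - x) * norm ?d"
      using \<phi>_lipschitz[OF x z diff_in_direction_space[OF y x]] .
    moreover have "(G ?z - G x) \<bullet> ?d = ?d \<bullet> G ?z - G x \<bullet> ?d"
      by (metis inner_diff_left inner_commute)
    ultimately have "?d \<bullet> G ?z - G x \<bullet> ?d - L * t * (norm ?d)\<^sup>2 \<le> 0"
      using t by (simp add: power2_eq_square mult.assoc)
    then show "\<exists>D. (F has_real_derivative D) (at t) \<and> D \<le> 0" using DF by blast
  qed simp
  then show ?thesis unfolding F_def by simp
qed

text \<open>The prox objective is \<open>1 / L\<close> times the quadratic model of \<open>\<phi> + h\<close> at \<open>x\<close>, up to a
  constant.\<close>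

lemma prox_grad_step:
  assumes x: "x \<in> X"
  shows "step x \<in> X"
    and "u \<in> X \<Longrightarrow> hr (step x) - (G x + L *\<^sub>R (step x - x)) \<bullet> (u - step x) \<le> hr u"
proof -
  let ?z = "x - (1 / L) *\<^sub>R G x"
  let ?F = "\<lambda>u. ereal ((norm (u - ?z))\<^sup>2 / 2) + h u / ereal L"
  have F: "?F u = ereal (1 / L * (0 \<bullet> u + L / 2 * (norm (u - ?z))\<^sup>2 + hr u) + 0)" if "u \<in> X" for u
  proof -
    have "?F u = ereal ((norm (u - ?z))\<^sup>2 / 2) + ereal (hr u) / ereal L"
      using proper_finite_on_edom[OF h that] by simp
    then show ?thesis using L_pos by (simp add: field_simps)
  qed
  have F_out: "?F u = \<infinity>" if "u \<notin> X" for u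
    using proper_outside_edom[OF that] L_pos by simp
  have p: "step x = (ARG_MIN ?F u. True)"
    by (simp add: prox_grad_step_def prox_def)
  note min = arg_min_quadratic_model[OF h comp less_imp_le[OF L_pos] _ F F_out p]
  show "step x \<in> X" using min(1) L_pos by simp
  have "0 + L *\<^sub>R (step x - ?z) = G x + L *\<^sub>R (step x - x)"
    using L_pos by (simp add: algebra_simps)
  then show "u \<in> X \<Longrightarrow> hr (step x) - (G x + L *\<^sub>R (step x - x)) \<bullet> (u - step x) \<le> hr u"
    using min(2)[of u] L_pos by simp
qed

text \<open>Add the descent inequality at the new point, strong convexity of \<open>\<phi>\<close> at \<open>x\<close> and the
  subgradient inequality of \<open>h\<close> at the new point.\<close>

lemma prox_grad_inequality:
  assumes x: "x \<in> X" and u: "u \<in> X"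
  shows "\<Phi> (step x) + L / 2 * (norm (u - step x))\<^sup>2
    \<le> \<Phi> u + (L - \<mu>) / 2 * (norm (u - x))\<^sup>2"
proof -
  let ?p = "step x"
  have "\<phi>r ?p \<le> \<phi>r x + G x \<bullet> (?p - x) + L / 2 * (norm (?p - x))\<^sup>2"
    using descent[OF x prox_grad_step(1)[OF x]] .
  moreover have "\<phi>r x + G x \<bullet> (u - x) + \<mu> / 2 * (norm (u - x))\<^sup>2 \<le> \<phi>r u"
    using \<phi>_strong[OF x u] .
  moreover have "hr ?p - (G x + L *\<^sub>R (?p - x)) \<bullet> (u - ?p) \<le> hr u"
    using prox_grad_step(2)[OF x u] .
  moreover have "G x \<bullet> (u - x) = G x \<bullet> (?p - x) + G x \<bullet> (u - ?p)"
    by (simp add: inner_diff)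
  moreover have "L / 2 * (norm (u - x))\<^sup>2
      = L / 2 * (norm (u - ?p))\<^sup>2 + L / 2 * (norm (?p - x))\<^sup>2 + L * ((?p - x) \<bullet> (u - ?p))"
    by (subst norm_sq_three_points[of u x ?p]) (simp add: algebra_simps)
  ultimately show ?thesis
    by (simp add: inner_add_left algebra_simps diff_divide_distrib add_divide_distrib)
qed

text \<open>The choice of \<open>y\<close> makes \<open>x' - y\<close> equal to \<open>a\<close> times the displacement of \<open>z'\<close> from its prox
  center \<open>a y + (1 - a) z\<close>. Hence the quadratic term of the descent inequality at \<open>x'\<close> is \<open>a\<close> times
  the one in the problem that \<open>z'\<close> solves, and the optimality of \<open>z'\<close> applies. As \<open>a\<^sup>2 L = \<mu>\<close>, strong
  convexity at \<open>y\<close> cancels the share of \<open>y\<close> in the prox center. The inequality is stated for every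
  \<open>u\<close>, so that it can be compared with the result of a proximal gradient step.\<close>

lemma accelerated_step:
  assumes x: "x \<in> X" and z: "z \<in> X"
    and y: "y = (1 / (1 + a)) *\<^sub>R (x + a *\<^sub>R z)"
    and z': "z' = (ARG_MIN (\<lambda>u. \<phi> y + ereal (G y \<bullet> (u - y)) + h u
                   + ereal (a * L / 2 * (norm (u - a *\<^sub>R y - (1 - a) *\<^sub>R z))\<^sup>2)) u. True)"
    and x': "x' = (1 - a) *\<^sub>R x + a *\<^sub>R z'"
  shows "z' \<in> X" "x' \<in> X"
    and "u \<in> X \<Longrightarrow> \<Phi> x' - \<Phi> u + \<mu> / 2 * (norm (u - z'))\<^sup>2
      \<le> (1 - a) * (\<Phi> x - \<Phi> u + \<mu> / 2 * (norm (u - z))\<^sup>2)"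
proof -
  let ?w = "a *\<^sub>R y + (1 - a) *\<^sub>R z"
  have a0: "0 \<le> a" "a \<le> 1" "0 < 1 + a" using a_bounds by linarith+
  have "1 - a / (1 + a) = 1 / (1 + a)" using a0 by (simp add: field_simps)
  then have y': "y = (1 - a / (1 + a)) *\<^sub>R x + (a / (1 + a)) *\<^sub>R z"
    unfolding y by (simp add: scaleR_right_distrib)
  have yX: "y \<in> X"
    unfolding y' by (rule X_convex[OF x z]) (use a0 in \<open>auto simp: field_simps\<close>)
  let ?F = "\<lambda>u. \<phi> y + ereal (G y \<bullet> (u - y)) + h u
                   + ereal (a * L / 2 * (norm (u - a *\<^sub>R y - (1 - a) *\<^sub>R z))\<^sup>2)"
  have w: "u - a *\<^sub>R y - (1 - a) *\<^sub>R z = u - ?w" for u by (simp add: algebra_simps)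
  have F: "?F u = ereal (1 * (G y \<bullet> u + (a * L) / 2 * (norm (u - ?w))\<^sup>2 + hr u)
      + (\<phi>r y - G y \<bullet> y))" if "u \<in> X" for u
  proof -
    have "?F u = ereal (\<phi>r y) + ereal (G y \<bullet> (u - y)) + ereal (hr u)
                   + ereal (a * L / 2 * (norm (u - ?w))\<^sup>2)"
      unfolding w using proper_finite_on_edom[OF h that] \<phi>_finite[OF yX] by simp
    then show ?thesis by (simp add: inner_diff_right)
  qed
  have F_out: "?F u = \<infinity>" if "u \<notin> X" for u
    using proper_outside_edom[OF that] \<phi>_finite[OF yX] by (cases "\<phi> y") auto
  have "0 \<le> a * L" using a0 L_pos by simp
  note min = arg_min_quadratic_model[OF h comp this _ F F_out z']
  show z'X: "z' \<in> X" using min(1) by simp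
  show x'X: "x' \<in> X" unfolding x' using X_convex[OF x z'X] a0 by simp
  assume u: "u \<in> X"
  have yxz: "(1 + a) *\<^sub>R y = x + a *\<^sub>R z" unfolding y using a0 by simp
  have "x' - y - a *\<^sub>R (z' - ?w) = (1 - a) *\<^sub>R (x + a *\<^sub>R z) - (1 - a * a) *\<^sub>R y"
    unfolding x' by (simp add: algebra_simps)
  also have "\<dots> = 0"
    unfolding yxz[symmetric] by (simp add: algebra_simps)
  finally have x'y: "x' - y = a *\<^sub>R (z' - ?w)" by simp
  then have "L / 2 * (norm (x' - y))\<^sup>2 = a * a * L / 2 * (norm (z' - ?w))\<^sup>2"
    by (simp add: power_mult_distrib power2_eq_square)
  then have quad: "L / 2 * (norm (x' - y))\<^sup>2 = \<mu> / 2 * (norm (z' - ?w))\<^sup>2"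
    unfolding a_sq .
  have lin: "G y \<bullet> (x' - y) = (1 - a) * (G y \<bullet> (x - y)) + a * (G y \<bullet> (z' - y))"
    unfolding x' by (simp add: inner_simps algebra_simps)
  have 1: "\<phi>r x' \<le> \<phi>r y + G y \<bullet> (x' - y) + L / 2 * (norm (x' - y))\<^sup>2"
    using descent[OF yX x'X] .
  have 2: "hr x' \<le> (1 - a) * hr x + a * hr z'"
    unfolding x' using proper_convexD(2)[OF h x z'X] a0 by simp
  have "0 \<le> \<mu> / 2 * (norm (x - y))\<^sup>2" using \<mu> by simp
  then have 3: "(1 - a) * (\<phi>r y + G y \<bullet> (x - y)) \<le> (1 - a) * \<phi>r x"
    using \<phi>_strong[OF yX x] a0 by (intro mult_left_mono) auto
  have "hr z' - (G y + (a * L) *\<^sub>R (z' - ?w)) \<bullet> (u - z') \<le> hr u"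
    using min(2)[of u] u by simp
  then have "a * (hr z' - G y \<bullet> (u - z')) - \<mu> * ((z' - ?w) \<bullet> (u - z')) \<le> a * hr u"
  proof -
    assume "hr z' - (G y + (a * L) *\<^sub>R (z' - ?w)) \<bullet> (u - z') \<le> hr u"
    then have "a * (hr z' - (G y + (a * L) *\<^sub>R (z' - ?w)) \<bullet> (u - z')) \<le> a * hr u"
      using a0 by (intro mult_left_mono)
    moreover have "a * ((G y + (a * L) *\<^sub>R (z' - ?w)) \<bullet> (u - z'))
        = a * (G y \<bullet> (u - z')) + a * a * L * ((z' - ?w) \<bullet> (u - z'))"
      by (simp add: inner_add_left algebra_simps)
    ultimately show ?thesis unfolding a_sq by (simp add: right_diff_distrib)
  qed
  moreover have "2 * ((z' - ?w) \<bullet> (u - z'))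
      = (norm (u - ?w))\<^sup>2 - (norm (u - z'))\<^sup>2 - (norm (z' - ?w))\<^sup>2"
    using norm_sq_three_points[of u ?w z'] by simp
  then have "\<mu> * ((z' - ?w) \<bullet> (u - z'))
      = \<mu> / 2 * ((norm (u - ?w))\<^sup>2 - (norm (u - z'))\<^sup>2 - (norm (z' - ?w))\<^sup>2)"
    by simp
  ultimately have 4: "a * (hr z' - G y \<bullet> (u - z'))
      - \<mu> / 2 * ((norm (u - ?w))\<^sup>2 - (norm (u - z'))\<^sup>2 - (norm (z' - ?w))\<^sup>2) \<le> a * hr u"
    by simp
  have 5: "a * (\<phi>r y + G y \<bullet> (u - y) + \<mu> / 2 * (norm (u - y))\<^sup>2) \<le> a * \<phi>r u"
    using \<phi>_strong[OF yX u] a0 by (intro mult_left_mono)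
  have "(norm (?w - u))\<^sup>2 \<le> a * (norm (y - u))\<^sup>2 + (1 - a) * (norm (z - u))\<^sup>2"
    using norm_sq_convex_combination[of "1 - a" y z u] a0 by simp
  then have 6: "\<mu> / 2 * (norm (u - ?w))\<^sup>2
      \<le> \<mu> / 2 * (a * (norm (u - y))\<^sup>2 + (1 - a) * (norm (u - z))\<^sup>2)"
    using \<mu> by (intro mult_left_mono) (auto simp: norm_minus_commute)
  have 7: "G y \<bullet> (z' - y) = G y \<bullet> (u - y) - G y \<bullet> (u - z')"
    by (simp add: inner_diff_right)
  show "\<Phi> x' - \<Phi> u + \<mu> / 2 * (norm (u - z'))\<^sup>2
      \<le> (1 - a) * (\<Phi> x - \<Phi> u + \<mu> / 2 * (norm (u - z))\<^sup>2)"
    using 1 2 3 4 5 6 unfolding quad lin 7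
    by (simp add: algebra_simps add_divide_distrib diff_divide_distrib)
qed

context
  fixes xm :: 'a and D :: real
  assumes xm: "xm \<in> X" and D: "\<And>x y. x \<in> X \<Longrightarrow> y \<in> X \<Longrightarrow> norm (x - y) \<le> D"
begin

text \<open>The prox-gradient inequality for the first step bounds the initial potential by
  \<open>L / 2\<close> times the squared distance from \<open>xm\<close> to the comparison point.\<close>

lemma inner_seq_potential:
  "fst (inner_seq \<phi> h \<mu> L xm j) \<in> X \<and> snd (inner_seq \<phi> h \<mu> L xm j) \<in> X \<and>
   (\<forall>u\<in>X. \<Phi> (fst (inner_seq \<phi> h \<mu> L xm j)) - \<Phi> u
      + \<mu> / 2 * (norm (u - snd (inner_seq \<phi> h \<mu> L xm j)))\<^sup>2 \<le> (1 - a) ^ j * (L / 2 * D\<^sup>2))"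
proof (induction j)
  case 0
  have "\<Phi> (step xm) - \<Phi> u + \<mu> / 2 * (norm (u - step xm))\<^sup>2 \<le> L / 2 * D\<^sup>2" if u: "u \<in> X" for u
  proof -
    have "\<Phi> (step xm) + L / 2 * (norm (u - step xm))\<^sup>2 \<le> \<Phi> u + (L - \<mu>) / 2 * (norm (u - xm))\<^sup>2"
      using prox_grad_inequality[OF xm u] .
    moreover have "\<mu> / 2 * (norm (u - step xm))\<^sup>2 \<le> L / 2 * (norm (u - step xm))\<^sup>2"
      using \<mu> by (intro mult_right_mono) auto
    moreover have "(L - \<mu>) / 2 * (norm (u - xm))\<^sup>2 \<le> L / 2 * D\<^sup>2"
      using \<mu> D[OF u xm] by (intro mult_mono power_mono) auto
    ultimately show ?thesis by linarith
  qed
  then show ?case using prox_grad_step(1)[OF xm] by simp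
next
  case (Suc j)
  obtain x z where xz: "inner_seq \<phi> h \<mu> L xm j = (x, z)" by fastforce
  define y where "y = (1 / (1 + a)) *\<^sub>R (x + a *\<^sub>R z)"
  define z' where "z' = (ARG_MIN (\<lambda>u. \<phi> y + ereal (G y \<bullet> (u - y)) + h u
                   + ereal (a * L / 2 * (norm (u - a *\<^sub>R y - (1 - a) *\<^sub>R z))\<^sup>2)) u. True)"
  define x' where "x' = (1 - a) *\<^sub>R x + a *\<^sub>R z'"
  have eq: "inner_seq \<phi> h \<mu> L xm (Suc j) = (x', z')"
    unfolding x'_def z'_def y_def by (simp add: xz Let_def a_def)
  have x: "x \<in> X" and z: "z \<in> X" using Suc xz by auto
  note step = accelerated_step[OF x z y_def z'_def x'_def]
  have "\<Phi> x' - \<Phi> u + \<mu> / 2 * (norm (u - z'))\<^sup>2 \<le> (1 - a) ^ Suc j * (L / 2 * D\<^sup>2)"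
    if u: "u \<in> X" for u
  proof -
    have "\<Phi> x - \<Phi> u + \<mu> / 2 * (norm (u - z))\<^sup>2 \<le> (1 - a) ^ j * (L / 2 * D\<^sup>2)"
      using Suc u xz by auto
    then have "(1 - a) * (\<Phi> x - \<Phi> u + \<mu> / 2 * (norm (u - z))\<^sup>2)
        \<le> (1 - a) * ((1 - a) ^ j * (L / 2 * D\<^sup>2))"
      using a_bounds by (intro mult_left_mono) auto
    then show ?thesis using step(3)[OF u] by simp
  qed
  then show ?case using step(1,2) unfolding eq by simp
qed

text \<open>A proximal gradient step from \<open>x\<^sup>j\<close> decreases the objective by at least \<open>L / 2\<close> times its
  squared length. The comparison point in the potential bound is the result of that step.\<close>

lemma prox_grad_step_length:
  assumes x: "x = fst (inner_seq \<phi> h \<mu> L xm j)"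
  shows "(norm (step x - x))\<^sup>2 \<le> (1 - a) ^ j * D\<^sup>2"
proof -
  have xX: "x \<in> X" using inner_seq_potential[of j] x by simp
  have "\<Phi> x - \<Phi> (step x) + \<mu> / 2 * (norm (step x - snd (inner_seq \<phi> h \<mu> L xm j)))\<^sup>2
      \<le> (1 - a) ^ j * (L / 2 * D\<^sup>2)"
    using inner_seq_potential[of j] prox_grad_step(1)[OF xX] x by blast
  moreover have "0 \<le> \<mu> / 2 * (norm (step x - snd (inner_seq \<phi> h \<mu> L xm j)))\<^sup>2"
    using \<mu> by simp
  moreover have "\<Phi> (step x) + L / 2 * (norm (x - step x))\<^sup>2 \<le> \<Phi> x"
    using prox_grad_inequality[OF xX xX] by simp
  ultimately have "L / 2 * (norm (step x - x))\<^sup>2 \<le> L / 2 * ((1 - a) ^ j * D\<^sup>2)"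
    by (simp add: norm_minus_commute algebra_simps)
  then show ?thesis using L_pos by simp
qed

text \<open>As \<open>(1 - a)\<^sup>j \<le> exp (- a j)\<close> and \<open>1 / a = sqrt (L / \<mu>)\<close>, this \<open>j\<close> makes the squared step
  length at most \<open>(tol / (2 L))\<^sup>2\<close>.\<close>

lemma inner_test_if_large:
  assumes tol: "0 < tol" and D0: "0 < D"
    and j: "2 * sqrt (L / \<mu>) * ln (2 * L * D / tol) \<le> real j"
  shows "inner_test \<phi> h \<mu> L xm tol j"
proof -
  define x where "x = fst (inner_seq \<phi> h \<mu> L xm j)"
  have pos: "0 < 2 * L * D / tol" using L_pos D0 tol by simp
  have "a * (2 * sqrt (L / \<mu>) * ln (2 * L * D / tol)) \<le> a * real j"
    using j a_bounds by (intro mult_left_mono) auto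
  moreover have "a * sqrt (L / \<mu>) = 1"
    using \<mu> L_pos unfolding a_def by (simp add: real_sqrt_mult[symmetric] del: real_sqrt_divide)
  moreover have "a * (2 * sqrt (L / \<mu>) * l) = a * sqrt (L / \<mu>) * (2 * l)" for l
    by (simp only: ac_simps)
  ultimately have aj: "2 * ln (2 * L * D / tol) \<le> a * real j"
    by (simp only: mult_1)
  have "1 - a \<le> exp (- a)" using exp_ge_add_one_self[of "- a"] by simp
  then have "(1 - a) ^ j \<le> exp (- a) ^ j" using a_bounds by (intro power_mono) auto
  also have "\<dots> = exp (- (a * real j))" by (simp add: exp_of_nat_mult[symmetric] mult.commute)
  also have "\<dots> \<le> exp (- (2 * ln (2 * L * D / tol)))" using aj by simp
  also have "\<dots> = 1 / (2 * L * D / tol)\<^sup>2"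
    using pos by (simp add: exp_minus exp_double divide_inverse)
  finally have "(1 - a) ^ j * D\<^sup>2 \<le> 1 / (2 * L * D / tol)\<^sup>2 * D\<^sup>2"
    by (rule mult_right_mono) simp
  also have "\<dots> = (tol / (2 * L))\<^sup>2" using D0 by (simp add: power_divide power_mult_distrib)
  finally have "(norm (step x - x))\<^sup>2 \<le> (tol / (2 * L))\<^sup>2"
    using prox_grad_step_length[OF x_def] by simp
  then have "norm (step x - x) \<le> tol / (2 * L)"
    by (rule power2_le_imp_le) (use tol L_pos in simp)
  then show ?thesis
    using L_pos unfolding inner_test_def Let_def x_def[symmetric] by (simp add: field_simps)
qed

theorem inner_method_complexity:
  assumes tol: "0 < tol" and D0: "0 < D"
  shows "inner_terminates \<phi> h \<mu> L xm tol"
    and "real (inner_iterations \<phi> h \<mu> L xm tol)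
      \<le> 2 + max 0 (2 * sqrt (L / \<mu>) * ln (2 * L * D / tol))"
proof -
  let ?b = "2 * sqrt (L / \<mu>) * ln (2 * L * D / tol)"
  have test: "inner_test \<phi> h \<mu> L xm tol (nat \<lceil>?b\<rceil>)"
    by (rule inner_test_if_large[OF tol D0]) linarith
  then show "inner_terminates \<phi> h \<mu> L xm tol"
    unfolding inner_terminates_def by blast
  have "(LEAST j. inner_test \<phi> h \<mu> L xm tol j) \<le> nat \<lceil>?b\<rceil>"
    using test by (rule Least_le)
  then show "real (inner_iterations \<phi> h \<mu> L xm tol) \<le> 2 + max 0 ?b"
    unfolding inner_iterations_def by linarith
qed

text \<open>The optimality condition of the last proximal gradient step gives a subgradient of \<open>h\<close> at
  the result. The gradient difference that separates it from stationarity is only controlled in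
  the direction space; its component orthogonal to that space can be moved into the subgradient,
  since the differences of points of the domain do not see it.\<close>

theorem inner_method_result:
  assumes stops: "inner_terminates \<phi> h \<mu> L xm tol"
  defines "p \<equiv> inner_result \<phi> h \<mu> L xm tol"
  shows "p \<in> X" and "\<exists>v\<in>subdifferential h p. norm (G p + v) \<le> tol"
proof -
  define j where "j = (LEAST j. inner_test \<phi> h \<mu> L xm tol j)"
  define x where "x = fst (inner_seq \<phi> h \<mu> L xm j)"
  have "inner_test \<phi> h \<mu> L xm tol j"
    using stops unfolding j_def inner_terminates_def by (rule LeastI_ex)
  moreover have p: "p = step x"
    unfolding p_def inner_result_def j_def x_def ..
  ultimately have test: "2 * L * norm (p - x) \<le> tol"
    unfolding inner_test_def x_def by (simp add: Let_def)
  have xX: "x \<in> X" using inner_seq_potential[of j] x_def by simp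
  show pX: "p \<in> X" unfolding p by (rule prox_grad_step(1)[OF xX])
  obtain e n where e: "e \<in> direction_space X"
    and n: "\<And>w. w \<in> direction_space X \<Longrightarrow> orthogonal n w"
    and en: "G p - G x = e + n"
    using orthogonal_subspace_decomp_exists[of "{a - b | a b. a \<in> X \<and> b \<in> X}" "G p - G x"]
    unfolding direction_space_def by blast
  define v where "v = - (G x + L *\<^sub>R (p - x)) - n"
  have "v \<in> subdifferential h p"
  proof (rule subdifferentialI_edom[OF h pX])
    fix u assume u: "u \<in> X"
    have "n \<bullet> (u - p) = 0"
      using n[OF diff_in_direction_space[OF u pX]] by (simp add: orthogonal_def)
    then show "hr p + v \<bullet> (u - p) \<le> hr u"
      using prox_grad_step(2)[OF xX u] unfolding v_def p by (simp add: inner_simps)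
  qed
  moreover have "norm (G p + v) \<le> tol"
  proof -
    have "norm e * norm e = (G p - G x) \<bullet> e"
      using n[OF e] by (simp add: en inner_add_left orthogonal_def norm_eq_square
          flip: power2_eq_square power2_norm_eq_inner)
    also have "\<dots> \<le> L * norm (p - x) * norm e" by (rule \<phi>_lipschitz[OF xX pX e])
    finally have "norm e \<le> L * norm (p - x)"
      using L_pos by (cases "e = 0") auto
    moreover have "G p + v = e - L *\<^sub>R (p - x)"
      using en unfolding v_def by (simp add: algebra_simps)
    ultimately have "norm (G p + v) \<le> L * norm (p - x) + L * norm (p - x)"
      using norm_triangle_ineq4[of e "L *\<^sub>R (p - x)"] L_pos by simp
    then show ?thesis using test by simp
  qed
  ultimately show "\<exists>v\<in>subdifferential h p. norm (G p + v) \<le> tol" by blast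
qed

end

end

section \<open>Projections onto closed convex cones\<close>

lemma closest_point_cone:
  fixes S :: "'b::euclidean_space set"
  assumes S: "closed S" "convex_cone S"
  shows "(u - closest_point S u) \<bullet> closest_point S u = 0"
    and "v \<in> S \<Longrightarrow> (u - closest_point S u) \<bullet> v \<le> 0"
proof -
  let ?p = "closest_point S u"
  have ne: "S \<noteq> {}" and cvx: "convex S" using S(2) by (auto simp: convex_cone_def)
  have p: "?p \<in> S" using closest_point_in_set[OF S(1) ne] .
  have dot: "(u - ?p) \<bullet> (v - ?p) \<le> 0" if "v \<in> S" for v
    using closest_point_dot[OF cvx S(1) that] .
  have "0 *\<^sub>R ?p \<in> S" "2 *\<^sub>R ?p \<in> S"
    by (intro convex_cone_scaleR[OF S(2)] p; simp)+
  from dot[OF this(1)] dot[OF this(2)] show orth: "(u - ?p) \<bullet> ?p = 0"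
    by (simp add: inner_simps)
  show "(u - ?p) \<bullet> v \<le> 0" if "v \<in> S"
    using dot[OF that] orth by (simp add: inner_diff_right)
qed

lemma closest_pointI_dot:
  fixes S :: "'b::euclidean_space set"
  assumes S: "closed S" "convex S" and p: "p \<in> S" and dot: "\<And>v. v \<in> S \<Longrightarrow> (u - p) \<bullet> (v - p) \<le> 0"
  shows "closest_point S u = p"
proof -
  have "dist u p \<le> dist u v" if "v \<in> S" for v
  proof -
    have "(norm (u - v))\<^sup>2 = (norm (u - p))\<^sup>2 + (norm (v - p))\<^sup>2 - 2 * ((u - p) \<bullet> (v - p))"
      unfolding power2_norm_eq_inner by (simp add: inner_simps inner_commute)
    then have "(norm (u - p))\<^sup>2 \<le> (norm (u - v))\<^sup>2"
      using dot[OF that] zero_le_power2[of "norm (v - p)"] by linarith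
    then show ?thesis unfolding dist_norm by (rule power2_le_imp_le) simp
  qed
  then show ?thesis using closest_point_unique[OF S(2,1) p] by metis
qed

lemma closed_dual_cone: "closed (dual_cone S)"
proof -
  have "dual_cone S = (\<Inter>x\<in>S. {y. 0 \<le> x \<bullet> y})"
    by (auto simp: dual_cone_def inner_commute)
  then show ?thesis by (auto intro!: closed_INT closed_halfspace_ge)
qed

lemma convex_cone_dual_cone: "convex_cone (dual_cone S)"
  unfolding convex_cone_def convex_def conic_def dual_cone_def
  by (auto simp: inner_add_left intro!: exI[of _ 0] add_nonneg_nonneg)

text \<open>Moreau's decomposition: subtracting from \<open>u\<close> its projection onto \<open>-S\<close> leaves its
  projection onto the dual cone.\<close>

lemma infdist_uminus_cone:
  fixes S :: "'b::euclidean_space set"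
  assumes S: "closed S" "convex_cone S"
  shows "infdist u (uminus ` S) = norm (closest_point (dual_cone S) u)"
proof -
  let ?N = "uminus ` S"
  define q where "q = closest_point ?N u"
  have clN: "closed ?N" using S(1) by (simp add: closed_negations)
  have ccN: "convex_cone ?N"
    using convex_cone_linear_image[of S uminus] S(2) by (simp add: linear_uminus)
  have neN: "?N \<noteq> {}" using S(2) by (auto simp: convex_cone_def)
  have qN: "q \<in> ?N" unfolding q_def by (rule closest_point_in_set[OF clN neN])
  have orth: "(u - q) \<bullet> q = 0" and polar: "\<And>v. v \<in> ?N \<Longrightarrow> (u - q) \<bullet> v \<le> 0"
    unfolding q_def using closest_point_cone[OF clN ccN] by auto
  have "u - q \<in> dual_cone S"
    using polar by (force simp: dual_cone_def)
  moreover have "(u - (u - q)) \<bullet> (v - (u - q)) \<le> 0" if "v \<in> dual_cone S" for v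
  proof -
    have "v \<bullet> q \<le> 0" using qN that by (auto simp: dual_cone_def)
    then show ?thesis using orth by (simp add: inner_diff_right inner_commute)
  qed
  ultimately have "closest_point (dual_cone S) u = u - q"
    using convex_cone_dual_cone[of S] by (intro closest_pointI_dot closed_dual_cone) (auto simp: convex_cone_def)
  moreover have "infdist u ?N = dist u q"
    unfolding q_def infdist_eq_setdist by (rule setdist_closest_point[OF clN neN])
  ultimately show ?thesis by (simp add: dist_norm)
qed

section \<open>Gradients\<close>

lemma grad_eqI:
  assumes "GDERIV (\<lambda>y. real_of_ereal (h y)) x :> D"
  shows "grad h x = D"
proof -
  have "D' = D" if "GDERIV (\<lambda>y. real_of_ereal (h y)) x :> D'" for D'
  proof -
    have "(\<lambda>d. d \<bullet> D') = (\<lambda>d. d \<bullet> D)"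
      using has_derivative_unique that assms unfolding gderiv_def by blast
    then have "d \<bullet> D' = d \<bullet> D" for d by meson
    then show ?thesis by (metis vector_eq_ldot)
  qed
  then show ?thesis unfolding grad_def using assms by (intro the_equality)
qed

lemma GDERIV_grad:
  assumes "(\<lambda>y. real_of_ereal (h y)) differentiable (at x)"
  shows "GDERIV (\<lambda>y. real_of_ereal (h y)) x :> grad h x"
proof -
  let ?D = "frechet_derivative (\<lambda>y. real_of_ereal (h y)) (at x)"
  have D: "((\<lambda>y. real_of_ereal (h y)) has_derivative ?D) (at x)"
    using assms frechet_derivative_works by blast
  then have lin: "linear ?D" by (rule has_derivative_linear)
  have "?D = (\<lambda>d. d \<bullet> adjoint ?D 1)"
    using adjoint_works[OF lin, of _ 1] by auto
  then have "GDERIV (\<lambda>y. real_of_ereal (h y)) x :> adjoint ?D 1"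
    using D unfolding gderiv_def by metis
  then show ?thesis using grad_eqI by metis
qed

lemma grad_map_inner:
  assumes "g differentiable (at x)"
  shows "blinfun_apply (grad_map g x) v \<bullet> d = v \<bullet> frechet_derivative g (at x) d"
proof -
  let ?D = "frechet_derivative g (at x)"
  have lin: "linear ?D"
    using assms has_derivative_linear frechet_derivative_works by blast
  have "blinfun_apply (grad_map g x) = adjoint ?D"
    unfolding grad_map_def
    by (intro bounded_linear_Blinfun_apply linear_conv_bounded_linear[THEN iffD1] adjoint_linear lin)
  then show ?thesis using adjoint_clauses(2)[OF lin] by simp
qed

section \<open>The subproblems\<close>

locale conic_program =
  fixes f P :: "'a::euclidean_space \<Rightarrow> ereal"
    and g :: "'a \<Rightarrow> 'b::euclidean_space"
    and K :: "'b set" and \<Omega> :: "'a set"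
    and Lf LG Lg Mg :: real
  assumes f: "proper_closed_convex f"
    and P: "proper_closed_convex P"
    and K: "closed K" "convex_cone K"
    and g: "cone_convex K g"
    and dom_P: "compact (edom P)"
    and \<Omega>: "open \<Omega>" "edom P \<subseteq> \<Omega>"
    and f_diff: "\<Omega> \<subseteq> edom f" "\<forall>x\<in>\<Omega>. (\<lambda>y. real_of_ereal (f y)) differentiable (at x)"
      "Lf-lipschitz_on \<Omega> (grad f)"
    and g_diff: "\<forall>x\<in>\<Omega>. g differentiable (at x)" "LG-lipschitz_on \<Omega> (grad_map g)"
    and Lg: "Lg-lipschitz_on (edom P) g"
    and Mg: "Mg = (SUP x\<in>edom P. norm (g x))"
begin

abbreviation "X \<equiv> edom P"
abbreviation "KD \<equiv> dual_cone K"
abbreviation "proj \<equiv> closest_point KD"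
abbreviation "fr x \<equiv> real_of_ereal (f x)"
abbreviation "Pr x \<equiv> real_of_ereal (P x)"
abbreviation "Dg x \<equiv> frechet_derivative g (at x)"
abbreviation "DgT x \<equiv> blinfun_apply (grad_map g x)"

lemma X_in_\<Omega>: "x \<in> X \<Longrightarrow> x \<in> \<Omega>"
  using \<Omega> by auto

lemma KD_convex: "convex KD" and KD_nonempty: "KD \<noteq> {}"
  using convex_cone_dual_cone[of K] by (auto simp: convex_cone_def)

lemma proj_in_KD: "proj u \<in> KD"
  by (rule closest_point_in_set[OF closed_dual_cone KD_nonempty])

lemma inner_proj: "u \<bullet> proj u = (norm (proj u))\<^sup>2"
  using closest_point_cone(1)[OF closed_dual_cone convex_cone_dual_cone, of u K]
  by (simp add: inner_diff_left power2_norm_eq_inner)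

lemma norm_proj_le: "norm (proj u) \<le> norm u"
proof -
  have "norm (proj u) * norm (proj u) \<le> norm u * norm (proj u)"
    using inner_proj[of u] norm_cauchy_schwarz[of u "proj u"] by (simp add: power2_eq_square)
  then show ?thesis by (cases "proj u = 0") auto
qed

lemma dist_proj_le: "norm (proj u - proj v) \<le> norm (u - v)"
  using closest_point_lipschitz[OF KD_convex closed_dual_cone KD_nonempty, of u v]
  by (simp add: dist_norm)

text \<open>Half the squared norm of the projection is the conjugate of the quadratic restricted to the
  dual cone, a supremum of affine functions.\<close>

lemma norm_proj_sq_ge:
  assumes v: "v \<in> KD"
  shows "v \<bullet> u - (norm v)\<^sup>2 / 2 \<le> (norm (proj u))\<^sup>2 / 2"
proof -
  have "(u - proj u) \<bullet> v \<le> 0"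
    by (rule closest_point_cone(2)[OF closed_dual_cone convex_cone_dual_cone v])
  moreover have "0 \<le> (norm (v - proj u))\<^sup>2" by simp
  ultimately show ?thesis
    unfolding power2_norm_eq_inner by (simp add: inner_simps inner_commute)
qed

lemma norm_proj_sq_subgradient:
  "(norm (proj u))\<^sup>2 / 2 + proj u \<bullet> (v - u) \<le> (norm (proj v))\<^sup>2 / 2"
  using norm_proj_sq_ge[OF proj_in_KD[of u], of v] inner_proj[of u]
  by (simp add: inner_diff_right inner_commute[of _ u])

text \<open>The subgradient inequalities at both points squeeze the error of the linear approximation
  below \<open>(norm (v - u))\<^sup>2\<close>, as the projection is nonexpansive.\<close>

lemma norm_proj_sq_has_derivative:
  "((\<lambda>u. (norm (proj u))\<^sup>2 / 2) has_derivative (\<lambda>d. d \<bullet> proj u)) (at u)"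
proof (rule has_derivativeI_sandwich[where e = 1 and H = "\<lambda>v. norm (v - u)"])
  fix v assume v: "v \<noteq> u"
  let ?e = "(norm (proj v))\<^sup>2 / 2 - (norm (proj u))\<^sup>2 / 2 - (v - u) \<bullet> proj u"
  have "0 \<le> ?e"
    using norm_proj_sq_subgradient[of u v] by (simp add: inner_commute)
  moreover have "?e \<le> (proj v - proj u) \<bullet> (v - u)"
    using norm_proj_sq_subgradient[of v u] by (simp add: inner_simps inner_commute)
  moreover have "(proj v - proj u) \<bullet> (v - u) \<le> norm (proj v - proj u) * norm (v - u)"
    by (rule norm_cauchy_schwarz)
  moreover have "\<dots> \<le> norm (v - u) * norm (v - u)"
    by (intro mult_right_mono dist_proj_le) simp
  ultimately have "norm ?e \<le> norm (v - u) * norm (v - u)" by simp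
  then show "norm ?e / norm (v - u) \<le> norm (v - u)"
    using v by (simp add: divide_le_eq)
next
  have "((\<lambda>v. norm (v - u)) \<longlongrightarrow> norm (u - u)) (at u)" by (intro tendsto_intros)
  then show "((\<lambda>v. norm (v - u)) \<longlongrightarrow> 0) (at u)" by simp
qed (auto intro: bounded_linear_inner_left)

lemma f_gderiv: "x \<in> \<Omega> \<Longrightarrow> GDERIV fr x :> grad f x"
  using f_diff by (intro GDERIV_grad) auto

lemma g_has_derivative: "x \<in> \<Omega> \<Longrightarrow> (g has_derivative Dg x) (at x)"
  using g_diff frechet_derivative_works by blast

lemma grad_map_g_inner: "x \<in> \<Omega> \<Longrightarrow> DgT x v \<bullet> d = v \<bullet> Dg x d"
  using g_diff by (intro grad_map_inner) auto

lemma f_gradient_inequality: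
  assumes x: "x \<in> \<Omega>" and y: "y \<in> edom f"
  shows "fr x + grad f x \<bullet> (y - x) \<le> fr y"
proof -
  have "x \<in> edom f" using x f_diff by auto
  then have "(y - x) \<bullet> grad f x \<le> fr y - fr x"
    using f_gderiv[OF x] proper_convexD(2)[OF f _ y, of x] unfolding gderiv_def
    by (intro convex_on_segment_derivative_le) auto
  then show ?thesis by (simp add: inner_commute)
qed

lemma inner_g_gradient_inequality:
  assumes x: "x \<in> \<Omega>" and v: "v \<in> KD"
  shows "v \<bullet> g x + DgT x v \<bullet> (y - x) \<le> v \<bullet> g y"
proof -
  have "((\<lambda>x. v \<bullet> g x) has_derivative (\<lambda>d. v \<bullet> Dg x d)) (at x)"
    by (intro derivative_intros g_has_derivative x)
  then have "v \<bullet> Dg x (y - x) \<le> v \<bullet> g y - v \<bullet> g x"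
  proof (rule convex_on_segment_derivative_le)
    fix s :: real assume s: "0 < s" "s \<le> 1"
    then have "cone_le K (g ((1 - s) *\<^sub>R x + (1 - (1 - s)) *\<^sub>R y))
        ((1 - s) *\<^sub>R g x + (1 - (1 - s)) *\<^sub>R g y)"
      using g unfolding cone_convex_def by (metis atLeastAtMost_iff diff_ge_0_iff_ge diff_le_self less_imp_le diff_left_mono diff_zero)
    then have "0 \<le> v \<bullet> ((1 - s) *\<^sub>R g x + s *\<^sub>R g y - g ((1 - s) *\<^sub>R x + s *\<^sub>R y))"
      using v unfolding cone_le_def dual_cone_def by auto
    then show "v \<bullet> g ((1 - s) *\<^sub>R x + s *\<^sub>R y) \<le> (1 - s) * (v \<bullet> g x) + s * (v \<bullet> g y)"
      by (simp add: inner_simps)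
  qed
  then show ?thesis using grad_map_g_inner[OF x] by simp
qed

lemma constants_nonneg: "0 \<le> Lf" "0 \<le> LG" "0 \<le> Lg"
  using f_diff(3) g_diff(2) Lg lipschitz_on_nonneg by blast+

lemma norm_g_le: "x \<in> X \<Longrightarrow> norm (g x) \<le> Mg"
proof -
  assume x: "x \<in> X"
  have "compact ((\<lambda>x. norm (g x)) ` X)"
    using lipschitz_on_continuous_on[OF Lg] dom_P
    by (intro compact_continuous_image continuous_intros)
  then have "bdd_above ((\<lambda>x. norm (g x)) ` X)"
    by (intro bounded_imp_bdd_above compact_imp_bounded)
  then show ?thesis unfolding Mg using x by (rule cSUP_upper2) simp
qed

lemma Mg_nonneg: "0 \<le> Mg"
  using norm_g_le edom_nonempty[OF P] by (metis all_not_in_conv norm_ge_zero order_trans)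

text \<open>The hypothesis concerns the adjoint; apply it to the difference of the derivatives.\<close>

lemma Dg_lipschitz:
  assumes x: "x \<in> \<Omega>" and y: "y \<in> \<Omega>"
  shows "norm (Dg x d - Dg y d) \<le> LG * norm (x - y) * norm d"
proof -
  let ?e = "Dg x d - Dg y d"
  have "norm ?e * norm ?e = (DgT x ?e - DgT y ?e) \<bullet> d"
    using grad_map_g_inner[OF x, of ?e d] grad_map_g_inner[OF y, of ?e d]
    by (simp add: inner_diff_left inner_diff_right power2_norm_eq_inner flip: power2_eq_square)
  also have "\<dots> = blinfun_apply (grad_map g x - grad_map g y) ?e \<bullet> d"
    by (simp add: blinfun.diff_left)
  also have "\<dots> \<le> norm (blinfun_apply (grad_map g x - grad_map g y) ?e) * norm d"
    by (rule norm_cauchy_schwarz)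
  also have "\<dots> \<le> norm (grad_map g x - grad_map g y) * norm ?e * norm d"
    by (intro mult_right_mono norm_blinfun) simp
  also have "\<dots> \<le> LG * norm (x - y) * norm ?e * norm d"
    using lipschitz_onD[OF g_diff(2) x y] by (intro mult_right_mono) (auto simp: dist_norm)
  finally have "norm ?e * norm ?e \<le> (LG * norm (x - y) * norm d) * norm ?e"
    by (simp add: ac_simps)
  then show ?thesis
    using constants_nonneg by (cases "?e = 0") auto
qed

text \<open>At a relative interior point the difference quotients of \<open>g\<close> in a direction of the affine
  hull only involve points of the domain of \<open>P\<close>, so \<open>Lg\<close> bounds them. Other points are limits of
  relative interior points, and the derivative is continuous.\<close>

lemma Dg_bound:
  assumes x: "x \<in> X" and d: "d \<in> direction_space X"
  shows "norm (Dg x d) \<le> Lg * norm d"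
proof -
  have interior: "norm (Dg y d) \<le> Lg * norm d" if y: "y \<in> rel_interior X" for y
  proof -
    obtain e where e: "0 < e" "ball y e \<inter> affine hull X \<subseteq> X" and yX: "y \<in> X"
      using y mem_rel_interior_ball by blast
    interpret D: bounded_linear "Dg y"
      using g_has_derivative[OF X_in_\<Omega>[OF yX]] by (rule has_derivative_bounded_linear)
    have "((\<lambda>t. y + t *\<^sub>R d) has_derivative (\<lambda>s. s *\<^sub>R d)) (at 0)"
      by (auto intro!: derivative_eq_intros)
    then have "((\<lambda>t. g (y + t *\<^sub>R d)) has_derivative (\<lambda>s. Dg y (s *\<^sub>R d))) (at 0)"
      by (rule has_derivative_compose) (use g_has_derivative[OF X_in_\<Omega>[OF yX]] in simp)
    then have quot: "((\<lambda>t. norm (g (y + t *\<^sub>R d) - g y - t *\<^sub>R Dg y d) / \<bar>t\<bar>) \<longlongrightarrow> 0) (at 0)"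
      by (simp add: has_derivative_iff_norm D.scaleR)
    have q: "norm (v - t *\<^sub>R w) / \<bar>t\<bar> = norm (v /\<^sub>R t - w)" if "t \<noteq> 0" for v w :: 'b and t
    proof -
      have "v /\<^sub>R t - w = (v - t *\<^sub>R w) /\<^sub>R t" using that by (simp add: scaleR_diff_right)
      then show ?thesis by (simp add: divide_inverse mult.commute)
    qed
    from quot have "((\<lambda>t. norm ((g (y + t *\<^sub>R d) - g y) /\<^sub>R t - Dg y d)) \<longlongrightarrow> 0) (at 0)"
      by (rule Lim_transform_eventually) (simp add: eventually_at_filter q)
    then have "((\<lambda>t. (g (y + t *\<^sub>R d) - g y) /\<^sub>R t) \<longlongrightarrow> Dg y d) (at 0)"
      by (rule LIM_zero_cancel[OF tendsto_norm_zero_cancel])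
    then have lim: "((\<lambda>t. norm ((g (y + t *\<^sub>R d) - g y) /\<^sub>R t)) \<longlongrightarrow> norm (Dg y d)) (at 0)"
      by (rule tendsto_norm)
    have "eventually (\<lambda>t. norm ((g (y + t *\<^sub>R d) - g y) /\<^sub>R t) \<le> Lg * norm d) (at 0)"
      unfolding eventually_at
    proof (intro exI[of _ "e / (norm d + 1)"] conjI ballI impI)
      show "0 < e / (norm d + 1)" using e by (intro divide_pos_pos) (auto intro: add_nonneg_pos)
      fix t :: real assume t: "t \<noteq> 0 \<and> dist t 0 < e / (norm d + 1)"
      have "\<bar>t\<bar> * norm d \<le> \<bar>t\<bar> * (norm d + 1)" by (intro mult_left_mono) auto
      also have "\<dots> < e" using t by (simp add: pos_less_divide_eq add_nonneg_pos)
      finally have "y + t *\<^sub>R d \<in> ball y e" by (simp add: dist_norm)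
      moreover have "t *\<^sub>R d \<in> direction_space X"
        using d unfolding direction_space_def by (rule span_scale)
      then have "y + t *\<^sub>R d \<in> affine hull X"
        by (intro affine_hull_add_direction hull_inc yX)
      ultimately have "y + t *\<^sub>R d \<in> X" using e by auto
      then have "norm (g (y + t *\<^sub>R d) - g y) \<le> Lg * (\<bar>t\<bar> * norm d)"
        using lipschitz_onD[OF Lg _ yX, of "y + t *\<^sub>R d"] by (simp add: dist_norm)
      moreover have "norm ((g (y + t *\<^sub>R d) - g y) /\<^sub>R t) = norm (g (y + t *\<^sub>R d) - g y) / \<bar>t\<bar>"
        by (simp add: divide_inverse mult.commute)
      ultimately show "norm ((g (y + t *\<^sub>R d) - g y) /\<^sub>R t) \<le> Lg * norm d"
        using t by (simp add: pos_divide_le_eq ac_simps)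
    qed
    then show ?thesis by (rule tendsto_upperbound[OF lim]) simp
  qed
  obtain z where z: "z \<in> rel_interior X"
    using rel_interior_eq_empty[OF convex_edom[OF P]] x by blast
  then have zX: "z \<in> X" using rel_interior_subset by blast
  have bound: "norm (Dg x d) \<le> Lg * norm d + s * (LG * norm (x - z) * norm d)" if s: "0 < s" "s \<le> 1" for s
  proof -
    let ?y = "x - s *\<^sub>R (x - z)"
    have y: "?y \<in> rel_interior X"
      by (rule rel_interior_convex_shrink[OF convex_edom[OF P] z x s])
    then have "?y \<in> X" using rel_interior_subset by blast
    then have "norm (Dg x d - Dg ?y d) \<le> LG * norm (x - ?y) * norm d"
      by (intro Dg_lipschitz X_in_\<Omega> x)
    also have "\<dots> = s * (LG * norm (x - z) * norm d)" using s by simp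
    finally show ?thesis
      using interior[OF y] norm_triangle_sub[of "Dg x d" "Dg ?y d"] by linarith
  qed
  let ?c = "LG * norm (x - z) * norm d"
  have "((\<lambda>s. Lg * norm d + s * ?c) \<longlongrightarrow> Lg * norm d + 0 * ?c) (at_right 0)"
    by (intro tendsto_intros)
  moreover have "eventually (\<lambda>s. norm (Dg x d) \<le> Lg * norm d + s * ?c) (at_right 0)"
    unfolding eventually_at_right_field using bound by (intro exI[of _ 1]) auto
  ultimately have "norm (Dg x d) \<le> Lg * norm d + 0 * ?c"
    by (rule tendsto_lowerbound) simp
  then show ?thesis by simp
qed

context
  fixes xc :: 'a and lam :: 'b and \<rho> :: real
  assumes \<rho>: "0 < \<rho>"
begin

abbreviation "\<pi> x \<equiv> proj (lam + \<rho> *\<^sub>R g x)"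
abbreviation "\<phi> \<equiv> sub_phi f g K (xc, lam) \<rho>"
abbreviation "\<phi>r x \<equiv> fr x + 1 / \<rho> * ((norm (\<pi> x))\<^sup>2 / 2) + 1 / (2 * \<rho>) * (norm (x - xc))\<^sup>2"

lemma sub_phi_eq:
  assumes x: "x \<in> \<Omega>"
  shows "\<phi> x = ereal (\<phi>r x)"
proof -
  have "ereal (fr x) = f x"
    using proper_finite_on_edom[OF f, of x] x f_diff(1) by auto
  then obtain r where "f x = ereal r" by metis
  then show ?thesis
    unfolding sub_phi_def smooth_part_def infdist_uminus_cone[OF K] by (simp add: mult.commute)
qed

lemma sub_phi_gderiv:
  assumes x: "x \<in> \<Omega>"
  shows "GDERIV (\<lambda>y. real_of_ereal (\<phi> y)) x :> grad f x + DgT x (\<pi> x) + (1 / \<rho>) *\<^sub>R (x - xc)"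
  unfolding gderiv_def
proof (rule has_derivative_transform_within_open[OF _ \<Omega>(1) x])
  have "((\<lambda>y. lam + \<rho> *\<^sub>R g y) has_derivative (\<lambda>d. \<rho> *\<^sub>R Dg x d)) (at x)"
    by (auto intro!: derivative_eq_intros g_has_derivative x)
  then have "((\<lambda>y. (norm (\<pi> y))\<^sup>2 / 2) has_derivative (\<lambda>d. (\<rho> *\<^sub>R Dg x d) \<bullet> \<pi> x)) (at x)"
    by (rule has_derivative_compose) (rule norm_proj_sq_has_derivative)
  then have pen: "((\<lambda>y. 1 / \<rho> * ((norm (\<pi> y))\<^sup>2 / 2)) has_derivative
      (\<lambda>d. 1 / \<rho> * ((\<rho> *\<^sub>R Dg x d) \<bullet> \<pi> x))) (at x)"
    by (rule has_derivative_mult_right)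
  have "((\<lambda>y. (y - xc) \<bullet> (y - xc)) has_derivative
      (\<lambda>d. (x - xc) \<bullet> d + d \<bullet> (x - xc))) (at x)"
    by (auto intro!: derivative_eq_intros)
  from has_derivative_mult_right[OF this, of "1 / (2 * \<rho>)"] have quad: "((\<lambda>y. 1 / (2 * \<rho>) * (norm (y - xc))\<^sup>2) has_derivative
      (\<lambda>d. 1 / (2 * \<rho>) * ((x - xc) \<bullet> d + d \<bullet> (x - xc)))) (at x)"
    unfolding power2_norm_eq_inner .
  have "(\<phi>r has_derivative (\<lambda>d. d \<bullet> grad f x + 1 / \<rho> * ((\<rho> *\<^sub>R Dg x d) \<bullet> \<pi> x)
      + 1 / (2 * \<rho>) * ((x - xc) \<bullet> d + d \<bullet> (x - xc)))) (at x)"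
    using f_gderiv[OF x] unfolding gderiv_def by (intro has_derivative_add pen quad)
  moreover have "d \<bullet> grad f x + 1 / \<rho> * ((\<rho> *\<^sub>R Dg x d) \<bullet> \<pi> x)
      + 1 / (2 * \<rho>) * ((x - xc) \<bullet> d + d \<bullet> (x - xc))
      = d \<bullet> (grad f x + DgT x (\<pi> x) + (1 / \<rho>) *\<^sub>R (x - xc))" for d
  proof -
    have "1 / (2 * \<rho>) * ((x - xc) \<bullet> d + d \<bullet> (x - xc)) = d \<bullet> ((1 / \<rho>) *\<^sub>R (x - xc))"
      using \<rho> unfolding inner_commute[of "x - xc" d] by simp
    moreover have "1 / \<rho> * ((\<rho> *\<^sub>R Dg x d) \<bullet> \<pi> x) = d \<bullet> DgT x (\<pi> x)"
      using grad_map_g_inner[OF x, of "\<pi> x" d] \<rho> by (simp add: inner_commute)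
    ultimately show ?thesis by (simp only: inner_add_right)
  qed
  ultimately show "(\<phi>r has_derivative
      (\<lambda>d. d \<bullet> (grad f x + DgT x (\<pi> x) + (1 / \<rho>) *\<^sub>R (x - xc)))) (at x)"
    by simp
qed (simp add: sub_phi_eq)

lemma grad_sub_phi:
  "x \<in> \<Omega> \<Longrightarrow> grad \<phi> x = grad f x + DgT x (\<pi> x) + (1 / \<rho>) *\<^sub>R (x - xc)"
  by (rule grad_eqI[OF sub_phi_gderiv])

text \<open>The penalty inherits convexity from \<open>g\<close>: its linearization uses the multiplier \<open>\<pi> x\<close>, which
  lies in the dual cone, and pairing \<open>g\<close> with such a multiplier gives a convex function. The
  proximal term contributes the modulus.\<close>

lemma sub_phi_strongly_convex:
  assumes x: "x \<in> X" and y: "y \<in> X"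
  shows "\<phi>r x + grad \<phi> x \<bullet> (y - x) + 1 / \<rho> / 2 * (norm (y - x))\<^sup>2 \<le> \<phi>r y"
proof -
  have x\<Omega>: "x \<in> \<Omega>" and yf: "y \<in> edom f" using x y \<Omega> f_diff(1) by auto
  have "fr x + grad f x \<bullet> (y - x) \<le> fr y" by (rule f_gradient_inequality[OF x\<Omega> yf])
  moreover have "1 / \<rho> * ((norm (\<pi> x))\<^sup>2 / 2) + DgT x (\<pi> x) \<bullet> (y - x) \<le> 1 / \<rho> * ((norm (\<pi> y))\<^sup>2 / 2)"
  proof -
    have "(norm (\<pi> x))\<^sup>2 / 2 + \<pi> x \<bullet> (\<rho> *\<^sub>R (g y - g x)) \<le> (norm (\<pi> y))\<^sup>2 / 2"
      using norm_proj_sq_subgradient[of "lam + \<rho> *\<^sub>R g x" "lam + \<rho> *\<^sub>R g y"]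
      by (simp add: scaleR_diff_right)
    then have "1 / \<rho> * ((norm (\<pi> x))\<^sup>2 / 2 + \<pi> x \<bullet> (\<rho> *\<^sub>R (g y - g x))) \<le> 1 / \<rho> * ((norm (\<pi> y))\<^sup>2 / 2)"
      using \<rho> by (intro mult_left_mono) auto
    moreover have "DgT x (\<pi> x) \<bullet> (y - x) \<le> \<pi> x \<bullet> (g y - g x)"
      using inner_g_gradient_inequality[OF x\<Omega> proj_in_KD, of "lam + \<rho> *\<^sub>R g x" y]
      by (simp add: inner_diff_right)
    moreover have "1 / \<rho> * (p + \<pi> x \<bullet> (\<rho> *\<^sub>R (g y - g x))) = 1 / \<rho> * p + \<pi> x \<bullet> (g y - g x)" for p
      using \<rho> by (simp add: distrib_left)
    ultimately show ?thesis by simp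
  qed
  moreover have "1 / (2 * \<rho>) * (norm (y - xc))\<^sup>2 = 1 / (2 * \<rho>) * (norm (x - xc))\<^sup>2
      + ((1 / \<rho>) *\<^sub>R (x - xc)) \<bullet> (y - x) + 1 / \<rho> / 2 * (norm (y - x))\<^sup>2"
  proof -
    have "(norm (y - xc))\<^sup>2 = (norm (x - xc))\<^sup>2 + 2 * ((x - xc) \<bullet> (y - x)) + (norm (y - x))\<^sup>2"
      unfolding power2_norm_eq_inner by (simp add: inner_simps inner_commute)
    then show ?thesis using \<rho> by (simp add: distrib_left)
  qed
  ultimately show ?thesis
    unfolding grad_sub_phi[OF x\<Omega>] inner_add_left by linarith
qed

text \<open>The difference of the penalty gradients splits into a change of the Jacobian, weighted by the
  multiplier at \<open>y\<close>, and a change of the multiplier, weighted by the Jacobian at \<open>x\<close>. The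
  second part is where \<open>d\<close> has to be parallel to the domain.\<close>

lemma sub_phi_gradient_lipschitz:
  assumes x: "x \<in> X" and y: "y \<in> X" and d: "d \<in> direction_space X"
  shows "(grad \<phi> y - grad \<phi> x) \<bullet> d \<le> sub_L Lf LG Lg Mg lam \<rho> * norm (y - x) * norm d"
proof -
  have \<Omega>xy: "x \<in> \<Omega>" "y \<in> \<Omega>" using x y X_in_\<Omega> by auto
  let ?n = "norm (y - x) * norm d"
  have "(grad f y - grad f x) \<bullet> d \<le> norm (grad f y - grad f x) * norm d"
    by (rule norm_cauchy_schwarz)
  also have "\<dots> \<le> Lf * norm (y - x) * norm d"
    using lipschitz_onD[OF f_diff(3) \<Omega>xy(2,1)] by (intro mult_right_mono) (auto simp: dist_norm)
  finally have 1: "(grad f y - grad f x) \<bullet> d \<le> Lf * ?n" by simp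
  have "\<pi> y \<bullet> (Dg y d - Dg x d) \<le> norm (\<pi> y) * norm (Dg y d - Dg x d)"
    by (rule norm_cauchy_schwarz)
  also have "\<dots> \<le> (norm lam + \<rho> * Mg) * (LG * norm (y - x) * norm d)"
  proof (intro mult_mono Dg_lipschitz \<Omega>xy)
    have "norm (\<pi> y) \<le> norm (lam + \<rho> *\<^sub>R g y)" by (rule norm_proj_le)
    also have "\<dots> \<le> norm lam + \<rho> * norm (g y)"
      using norm_triangle_ineq[of lam "\<rho> *\<^sub>R g y"] \<rho> by simp
    also have "\<dots> \<le> norm lam + \<rho> * Mg"
      using norm_g_le[OF y] \<rho> by simp
    finally show "norm (\<pi> y) \<le> norm lam + \<rho> * Mg" .
  qed (use \<rho> Mg_nonneg in auto)
  finally have 2: "\<pi> y \<bullet> (Dg y d - Dg x d) \<le> LG * (norm lam + \<rho> * Mg) * ?n"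
    by (simp add: ac_simps)
  have "(\<pi> y - \<pi> x) \<bullet> Dg x d \<le> norm (\<pi> y - \<pi> x) * norm (Dg x d)"
    by (rule norm_cauchy_schwarz)
  also have "\<dots> \<le> (\<rho> * (Lg * norm (y - x))) * (Lg * norm d)"
  proof (intro mult_mono Dg_bound x d)
    have "norm (\<pi> y - \<pi> x) \<le> norm ((lam + \<rho> *\<^sub>R g y) - (lam + \<rho> *\<^sub>R g x))"
      by (rule dist_proj_le)
    also have "\<dots> = \<rho> * norm (g y - g x)"
      using \<rho> by (simp flip: scaleR_diff_right)
    also have "\<dots> \<le> \<rho> * (Lg * norm (y - x))"
      using lipschitz_onD[OF Lg y x] \<rho> by (intro mult_left_mono) (auto simp: dist_norm)
    finally show "norm (\<pi> y - \<pi> x) \<le> \<rho> * (Lg * norm (y - x))" .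
  qed (use \<rho> constants_nonneg in auto)
  finally have 3: "(\<pi> y - \<pi> x) \<bullet> Dg x d \<le> \<rho> * Lg\<^sup>2 * ?n"
    by (simp add: power2_eq_square ac_simps)
  have "(1 / \<rho>) * ((y - x) \<bullet> d) \<le> (1 / \<rho>) * ?n"
    using \<rho> by (intro mult_left_mono norm_cauchy_schwarz) auto
  moreover have "(grad \<phi> y - grad \<phi> x) \<bullet> d
      = (grad f y - grad f x) \<bullet> d + (\<pi> y \<bullet> (Dg y d - Dg x d) + (\<pi> y - \<pi> x) \<bullet> Dg x d)
        + (1 / \<rho>) * ((y - x) \<bullet> d)"
    using grad_map_g_inner[OF \<Omega>xy(1), of "\<pi> x" d] grad_map_g_inner[OF \<Omega>xy(2), of "\<pi> y" d]
    by (simp add: grad_sub_phi[OF \<Omega>xy(1)] grad_sub_phi[OF \<Omega>xy(2)] inner_add_left inner_diff_left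
        inner_diff_right diff_divide_distrib)
  ultimately have "(grad \<phi> y - grad \<phi> x) \<bullet> d \<le> Lf * ?n + LG * (norm lam + \<rho> * Mg) * ?n
      + \<rho> * Lg\<^sup>2 * ?n + 1 / \<rho> * ?n"
    using 1 2 3 by linarith
  also have "\<dots> = sub_L Lf LG Lg Mg lam \<rho> * ?n"
    unfolding sub_L_def by (simp add: distrib_right)
  finally show ?thesis by simp
qed

lemma sub_L_ge: "1 / \<rho> \<le> sub_L Lf LG Lg Mg lam \<rho>"
  unfolding sub_L_def using constants_nonneg Mg_nonneg \<rho>
  by simp

lemma subproblem: "composite_problem \<phi> P (1 / \<rho>) (sub_L Lf LG Lg Mg lam \<rho>)"
proof
  fix x y assume x: "x \<in> X"
  then show "ereal (real_of_ereal (\<phi> x)) = \<phi> x"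
    by (simp add: sub_phi_eq X_in_\<Omega>)
  show "GDERIV (\<lambda>y. real_of_ereal (\<phi> y)) x :> grad \<phi> x"
    unfolding grad_sub_phi[OF X_in_\<Omega>[OF x]] by (rule sub_phi_gderiv[OF X_in_\<Omega>[OF x]])
  assume y: "y \<in> X"
  show "real_of_ereal (\<phi> x) + grad \<phi> x \<bullet> (y - x) + 1 / \<rho> / 2 * (norm (y - x))\<^sup>2 \<le> real_of_ereal (\<phi> y)"
    using sub_phi_strongly_convex[OF x y] by (simp add: sub_phi_eq X_in_\<Omega> x y)
  show "d \<in> direction_space X \<Longrightarrow>
      (grad \<phi> y - grad \<phi> x) \<bullet> d \<le> sub_L Lf LG Lg Mg lam \<rho> * norm (y - x) * norm d" for d
    by (rule sub_phi_gradient_lipschitz[OF x y])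
qed (use P dom_P \<rho> sub_L_ge in auto)

end

end

section \<open>Inexact proximal steps at a saddle point\<close>

text \<open>Here \<open>w'\<close> is the perturbed starting point \<open>w\<close> of a proximal step that ends in \<open>p\<close>, and
  \<open>s\<close> is a zero of the operator. The hypothesis says that \<open>p\<close> lies in the ball that has the segment
  from \<open>w'\<close> to \<open>s\<close> as a diameter. Its distance to \<open>w\<close> is estimated through the center of that ball;
  estimating it through \<open>w'\<close> would cost \<open>2 \<sigma>\<close> instead of \<open>\<sigma>\<close>.\<close>

lemma inexact_proximal_point:
  fixes p s w w' :: "'a::real_inner"
  assumes obtuse: "0 \<le> (p - w') \<bullet> (s - p)" and w': "norm (w' - w) \<le> \<sigma>"
  shows "norm (p - s) \<le> norm (w - s) + \<sigma>" and "norm (p - w) \<le> norm (w - s) + \<sigma>"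
proof -
  have w's: "norm (w' - s) \<le> norm (w - s) + \<sigma>"
    using norm_triangle_ineq[of "w' - w" "w - s"] w' by simp
  have "norm (p - s) * norm (p - s) \<le> (w' - s) \<bullet> (p - s)"
    using obtuse by (simp add: inner_simps inner_commute flip: power2_eq_square power2_norm_eq_inner)
      (simp add: power2_norm_eq_inner inner_simps inner_commute)
  also have "\<dots> \<le> norm (w' - s) * norm (p - s)" by (rule norm_cauchy_schwarz)
  finally have "norm (p - s) \<le> norm (w' - s)" by (cases "p = s") auto
  with w's show "norm (p - s) \<le> norm (w - s) + \<sigma>" by simp
  let ?m = "(1 / 2) *\<^sub>R (w' + s)"
  have "(norm (p - ?m))\<^sup>2 = (norm ((1 / 2) *\<^sub>R (w' - s)))\<^sup>2 - (p - w') \<bullet> (s - p)"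
    unfolding power2_norm_eq_inner by (simp add: inner_simps inner_commute field_simps)
  then have "(norm (p - ?m))\<^sup>2 \<le> (norm ((1 / 2) *\<^sub>R (w' - s)))\<^sup>2" using obtuse by simp
  then have "norm (p - ?m) \<le> norm ((1 / 2) *\<^sub>R (w' - s))" by (rule power2_le_imp_le) simp
  moreover have "?m - w = (1 / 2) *\<^sub>R ((w' - w) + (s - w))"
  proof -
    have "w = (1 / 2) *\<^sub>R w + (1 / 2) *\<^sub>R w" by (simp flip: scaleR_add_left)
    then show ?thesis by (simp add: algebra_simps)
  qed
  then have "norm (?m - w) \<le> (norm (w' - w) + norm (s - w)) / 2"
    using norm_triangle_ineq[of "w' - w" "s - w"] by simp
  ultimately show "norm (p - w) \<le> norm (w - s) + \<sigma>"
    using norm_triangle_ineq[of "p - ?m" "?m - w"] w's w' by (simp add: norm_minus_commute)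
qed

context conic_program
begin

text \<open>By strong duality the objective at \<open>xs\<close> is a lower bound of the Lagrangian at \<open>ls\<close>, and
  feasibility makes \<open>v \<bullet> g xs\<close> nonpositive.\<close>

lemma saddle_point:
  assumes xs: "xs \<in> primal_solutions f P g K" and ls: "ls \<in> dual_solutions f P g K"
    and eq: "primal_value f P g K = dual_value f P g K"
  shows "xs \<in> X" "ls \<in> KD"
    and "u \<in> X \<Longrightarrow> v \<in> KD \<Longrightarrow> fr xs + Pr xs + v \<bullet> g xs \<le> fr u + Pr u + ls \<bullet> g u"
proof -
  have fin: "f u = ereal (fr u)" "P u = ereal (Pr u)" if "u \<in> X" for u
    using proper_finite_on_edom[OF f, of u] proper_finite_on_edom[OF P, of u] that \<Omega> f_diff(1)
    by auto
  have "f xs + P xs = dual_function f P g ls"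
    using xs ls eq by (simp add: primal_solutions_def dual_solutions_def)
  then have le: "f xs + P xs \<le> f u + P u + ereal (ls \<bullet> g u)" for u
    unfolding dual_function_def using INF_lower[of u UNIV "\<lambda>u. f u + P u + ereal (ls \<bullet> g u)"] by simp
  obtain u0 where u0: "u0 \<in> X" using edom_nonempty[OF P] by blast
  have "f xs \<noteq> - \<infinity>" using f by (simp add: proper_closed_convex_def)
  then have "P xs \<noteq> \<infinity>"
    using le[of u0] fin[OF u0] by (cases "f xs") auto
  then show xsX: "xs \<in> X" by (simp add: edom_def)
  show "ls \<in> KD" using ls by (simp add: dual_solutions_def)
  assume u: "u \<in> X" and v: "v \<in> KD"
  have "0 - g xs \<in> K" using xs by (simp add: primal_solutions_def feasible_def cone_le_def)
  then have "v \<bullet> g xs \<le> 0" using v unfolding dual_cone_def by fastforce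
  moreover have "ereal (fr xs) + ereal (Pr xs) \<le> ereal (fr u) + ereal (Pr u) + ereal (ls \<bullet> g u)"
    using le[of u] fin[OF xsX] fin[OF u] by metis
  ultimately show "fr xs + Pr xs + v \<bullet> g xs \<le> fr u + Pr u + ls \<bullet> g u" by simp
qed

text \<open>One outer iteration is a proximal step for the saddle operator of the Lagrangian, started at
  the iterate shifted by \<open>\<rho> r\<close> in its first component, where \<open>r\<close> is the residual of the subproblem.
  The claim adds the subgradient inequality in \<open>x\<close> for the Lagrangian at the new multiplier, the
  variational inequality of the projection, and the saddle point inequality.\<close>

lemma outer_step_obtuse:
  assumes \<rho>: "0 < \<rho>" and x': "x' \<in> X" and v: "v \<in> subdifferential P x'"
    and l': "l' = proj (l + \<rho> *\<^sub>R g x')"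
    and r: "r = grad (sub_phi f g K (x, l) \<rho>) x' + v"
    and xs: "xs \<in> X" and ls: "ls \<in> KD"
    and saddle: "\<And>u \<nu>. u \<in> X \<Longrightarrow> \<nu> \<in> KD \<Longrightarrow> fr xs + Pr xs + \<nu> \<bullet> g xs \<le> fr u + Pr u + ls \<bullet> g u"
  shows "0 \<le> ((x', l') - ((x, l) + (\<rho> *\<^sub>R r, 0))) \<bullet> ((xs, ls) - (x', l'))"
proof -
  have x'\<Omega>: "x' \<in> \<Omega>" and xsf: "xs \<in> edom f" using x' xs \<Omega> f_diff(1) by auto
  have l'K: "l' \<in> KD" unfolding l' by (rule proj_in_KD)
  have r': "r = grad f x' + DgT x' l' + (1 / \<rho>) *\<^sub>R (x' - x) + v"
    unfolding r l' grad_sub_phi[OF \<rho> x'\<Omega>] ..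
  have "fr x' + grad f x' \<bullet> (xs - x') \<le> fr xs"
    by (rule f_gradient_inequality[OF x'\<Omega> xsf])
  moreover have "Pr x' + v \<bullet> (xs - x') \<le> Pr xs"
    by (rule subdifferentialD_edom[OF P x' xs v])
  moreover have "l' \<bullet> g x' + DgT x' l' \<bullet> (xs - x') \<le> l' \<bullet> g xs"
    by (rule inner_g_gradient_inequality[OF x'\<Omega> l'K])
  moreover have "fr xs + Pr xs + l' \<bullet> g xs \<le> fr x' + Pr x' + ls \<bullet> g x'"
    by (rule saddle[OF x' l'K])
  ultimately have "(r - (1 / \<rho>) *\<^sub>R (x' - x)) \<bullet> (xs - x') \<le> g x' \<bullet> (ls - l')"
    unfolding r' by (simp add: inner_add_left inner_diff_right inner_commute[of "g x'"])
  then have "\<rho> * ((r - (1 / \<rho>) *\<^sub>R (x' - x)) \<bullet> (xs - x')) \<le> \<rho> * (g x' \<bullet> (ls - l'))"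
    using \<rho> by simp
  moreover have "\<rho> * ((r - (1 / \<rho>) *\<^sub>R (x' - x)) \<bullet> (xs - x')) = (\<rho> *\<^sub>R r - (x' - x)) \<bullet> (xs - x')"
    using \<rho> by (simp add: inner_diff_left right_diff_distrib)
  moreover have "(l + \<rho> *\<^sub>R g x' - l') \<bullet> (ls - l') \<le> 0"
    unfolding l' by (rule closest_point_dot[OF KD_convex closed_dual_cone ls])
  then have "\<rho> * (g x' \<bullet> (ls - l')) \<le> (l' - l) \<bullet> (ls - l')"
    by (simp add: inner_diff_left inner_add_left)
  ultimately have "(\<rho> *\<^sub>R r - (x' - x)) \<bullet> (xs - x') \<le> (l' - l) \<bullet> (ls - l')" by linarith
  then show ?thesis by (simp add: inner_diff_left inner_add_left)
qed

text \<open>The residual of the subproblem differs from the residuals of the optimality conditions by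
  the two components of the scaled displacement.\<close>

lemma eps_KKT_if_short_step:
  assumes \<rho>: "0 < \<rho>" and x': "x' \<in> X" and v: "v \<in> subdifferential P x'"
    and l': "l' = proj (l + \<rho> *\<^sub>R g x')"
    and r: "norm (grad (sub_phi f g K (x, l) \<rho>) x' + v) \<le> \<eta>"
    and step: "1 / \<rho> * norm ((x', l') - (x, l)) \<le> \<epsilon> / 2" and \<eta>: "\<eta> \<le> \<epsilon> / 2"
  shows "eps_KKT f P g K \<epsilon> (x', l')"
proof -
  have x'\<Omega>: "x' \<in> \<Omega>" using x' \<Omega> by auto
  have "norm (x' - x) \<le> norm ((x', l') - (x, l))" "norm (l' - l) \<le> norm ((x', l') - (x, l))"
    using norm_fst_le[of "x' - x" "l' - l"] norm_snd_le[of "l' - l" "x' - x"] by auto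
  then have "1 / \<rho> * norm (x' - x) \<le> 1 / \<rho> * norm ((x', l') - (x, l))"
      "1 / \<rho> * norm (l' - l) \<le> 1 / \<rho> * norm ((x', l') - (x, l))"
    using \<rho> by (auto intro!: divide_right_mono simp del: diff_Pair)
  moreover have "\<bar>1 / \<rho>\<bar> = 1 / \<rho>" using \<rho> by simp
  ultimately have dx: "norm ((1 / \<rho>) *\<^sub>R (x' - x)) \<le> \<epsilon> / 2" and dl: "norm ((1 / \<rho>) *\<^sub>R (l' - l)) \<le> \<epsilon> / 2"
    using step unfolding norm_scaleR by linarith+
  let ?s = "grad f x' + v + DgT x' l'"
  have s: "?s = (grad (sub_phi f g K (x, l) \<rho>) x' + v) - (1 / \<rho>) *\<^sub>R (x' - x)"
    unfolding grad_sub_phi[OF \<rho> x'\<Omega>] l' by simp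
  have "norm ?s \<le> \<epsilon>"
    unfolding s using norm_triangle_ineq4[of "grad (sub_phi f g K (x, l) \<rho>) x' + v" "(1 / \<rho>) *\<^sub>R (x' - x)"]
      r dx \<eta> by linarith
  then have stat: "edist_set 0 {grad f x' + v + DgT x' l' | v. v \<in> subdifferential P x'} \<le> ereal \<epsilon>"
    unfolding edist_set_def using v by (intro INF_lower2[of ?s]) auto
  let ?n = "g x' - (1 / \<rho>) *\<^sub>R (l' - l)"
  have "?n \<bullet> (y - l') \<le> 0" if y: "y \<in> KD" for y
  proof -
    have "(l + \<rho> *\<^sub>R g x' - l') \<bullet> (y - l') \<le> 0"
      unfolding l' by (rule closest_point_dot[OF KD_convex closed_dual_cone y])
    moreover have "l + \<rho> *\<^sub>R g x' - l' = \<rho> *\<^sub>R ?n" using \<rho> by (simp add: algebra_simps)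
    ultimately show ?thesis using \<rho> by (simp add: mult_le_0_iff)
  qed
  moreover have l'K: "l' \<in> KD" unfolding l' by (rule proj_in_KD)
  ultimately have "?n \<in> normal_cone KD l'" by (simp add: normal_cone_def)
  moreover have "dist (g x') ?n \<le> \<epsilon>"
  proof -
    have "dist (g x') ?n = norm ((1 / \<rho>) *\<^sub>R (l' - l))" unfolding dist_norm by simp
    then show ?thesis using dl norm_ge_zero[of "(1 / \<rho>) *\<^sub>R (l' - l)"] by linarith
  qed
  ultimately have "edist_set (g x') (normal_cone KD l') \<le> ereal \<epsilon>"
    unfolding edist_set_def by (intro INF_lower2[of ?n]) auto
  then show ?thesis using stat x' l'K by (simp add: eps_KKT_def)
qed

end

section \<open>The outer iterations\<close>

locale outer_run = conic_program f P g K \<Omega> Lf LG Lg Mg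
  for f P :: "'a::euclidean_space \<Rightarrow> ereal" and g :: "'a \<Rightarrow> 'b::euclidean_space"
    and K \<Omega> Lf LG Lg Mg +
  fixes \<rho> \<eta> :: "nat \<Rightarrow> real" and xm :: "nat \<Rightarrow> 'a" and w0 :: "'a \<times> 'b" and D :: real
  assumes \<rho>: "\<And>k. 0 < \<rho> k" and \<eta>: "\<And>k. 0 < \<eta> k" and xm: "\<And>k. xm k \<in> X"
    and D0: "0 < D" and D: "\<And>x y. x \<in> X \<Longrightarrow> y \<in> X \<Longrightarrow> norm (x - y) \<le> D"
begin

abbreviation "L \<equiv> sub_L Lf LG Lg Mg"
abbreviation "w \<equiv> outer_seq f P g K L \<rho> \<eta> xm w0"

lemma outer_step:
  shows "outer_inner_terminates f P g K L \<rho> \<eta> xm w0 k"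
    and "real (outer_inner_iterations f P g K L \<rho> \<eta> xm w0 k)
      \<le> 2 + max 0 (2 * sqrt (L (snd (w k)) (\<rho> k) * \<rho> k) * ln (2 * L (snd (w k)) (\<rho> k) * D / \<eta> k))"
    and "\<exists>x' v. x' \<in> X \<and> v \<in> subdifferential P x' \<and>
      norm (grad (sub_phi f g K (w k) (\<rho> k)) x' + v) \<le> \<eta> k \<and>
      w (Suc k) = (x', proj (snd (w k) + \<rho> k *\<^sub>R g x'))"
proof -
  obtain x l where w: "w k = (x, l)" by fastforce
  have sub: "composite_problem (sub_phi f g K (x, l) (\<rho> k)) P (1 / \<rho> k) (L l (\<rho> k))"
    by (rule subproblem[OF \<rho>])
  note compl = composite_problem.inner_method_complexity[OF sub xm D \<eta>[of k] D0]
  have ter: "inner_terminates (sub_phi f g K (x, l) (\<rho> k)) P (1 / \<rho> k) (L l (\<rho> k)) (xm k) (\<eta> k)"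
    by (rule compl(1))
  then show "outer_inner_terminates f P g K L \<rho> \<eta> xm w0 k"
    by (simp add: outer_inner_terminates_def w Let_def)
  show "real (outer_inner_iterations f P g K L \<rho> \<eta> xm w0 k)
      \<le> 2 + max 0 (2 * sqrt (L (snd (w k)) (\<rho> k) * \<rho> k) * ln (2 * L (snd (w k)) (\<rho> k) * D / \<eta> k))"
    using compl(2)[of k] by (simp add: outer_inner_iterations_def w Let_def)
  show "\<exists>x' v. x' \<in> X \<and> v \<in> subdifferential P x' \<and>
      norm (grad (sub_phi f g K (w k) (\<rho> k)) x' + v) \<le> \<eta> k \<and>
      w (Suc k) = (x', proj (snd (w k) + \<rho> k *\<^sub>R g x'))"
    using composite_problem.inner_method_result[OF sub xm D ter] by (auto simp: w Let_def)
qed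

text \<open>The residuals enter additively, each weighted by its proximal parameter.\<close>

lemma outer_distances:
  assumes xs: "xs \<in> X" and ls: "ls \<in> KD"
    and saddle: "\<And>u \<nu>. u \<in> X \<Longrightarrow> \<nu> \<in> KD \<Longrightarrow> fr xs + Pr xs + \<nu> \<bullet> g xs \<le> fr u + Pr u + ls \<bullet> g u"
  shows "norm (w k - (xs, ls)) \<le> norm (w0 - (xs, ls)) + (\<Sum>i<k. \<rho> i * \<eta> i)"
    and "norm (w (Suc k) - w k) \<le> norm (w0 - (xs, ls)) + (\<Sum>i<Suc k. \<rho> i * \<eta> i)"
proof -
  have one: "norm (w (Suc k) - (xs, ls)) \<le> norm (w k - (xs, ls)) + \<rho> k * \<eta> k \<and>
      norm (w (Suc k) - w k) \<le> norm (w k - (xs, ls)) + \<rho> k * \<eta> k" for k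
  proof -
    obtain x l where w: "w k = (x, l)" by fastforce
    obtain x' v where x': "x' \<in> X" and v: "v \<in> subdifferential P x'"
      and r: "norm (grad (sub_phi f g K (x, l) (\<rho> k)) x' + v) \<le> \<eta> k"
      and w': "w (Suc k) = (x', proj (l + \<rho> k *\<^sub>R g x'))"
      using outer_step(3)[of k] unfolding w by auto
    let ?r = "grad (sub_phi f g K (x, l) (\<rho> k)) x' + v"
    have "0 \<le> (w (Suc k) - (w k + (\<rho> k *\<^sub>R ?r, 0))) \<bullet> ((xs, ls) - w (Suc k))"
      unfolding w w' by (rule outer_step_obtuse[OF \<rho> x' v refl refl xs ls saddle])
    moreover have "norm ((w k + (\<rho> k *\<^sub>R ?r, 0)) - w k) \<le> \<rho> k * \<eta> k"
      using r \<rho>[of k] by (simp add: norm_Pair)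
    ultimately show ?thesis by (intro conjI inexact_proximal_point)
  qed
  show k: "norm (w k - (xs, ls)) \<le> norm (w0 - (xs, ls)) + (\<Sum>i<k. \<rho> i * \<eta> i)" for k
  proof (induction k)
    case (Suc k)
    then show ?case using one[of k] by simp
  qed simp
  show "norm (w (Suc k) - w k) \<le> norm (w0 - (xs, ls)) + (\<Sum>i<Suc k. \<rho> i * \<eta> i)"
    using k[of k] one[of k] by simp
qed

lemma eps_KKT_if_outer_test:
  assumes "outer_test f P g K L \<rho> \<eta> xm w0 \<epsilon> k"
  shows "eps_KKT f P g K \<epsilon> (w (Suc k))"
proof -
  obtain x l where w: "w k = (x, l)" by fastforce
  obtain x' v where x': "x' \<in> X" "v \<in> subdifferential P x'"
      and r: "norm (grad (sub_phi f g K (x, l) (\<rho> k)) x' + v) \<le> \<eta> k"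
      and w': "w (Suc k) = (x', proj (l + \<rho> k *\<^sub>R g x'))"
      using outer_step(3)[of k] unfolding w by auto
  from assms consider "eps_KKT f P g K \<epsilon> (w (Suc k))"
    | "1 / \<rho> k * norm (w (Suc k) - w k) \<le> \<epsilon> / 2" "\<eta> k \<le> \<epsilon> / 2"
    unfolding outer_test_def Let_def by blast
  then show ?thesis
  proof cases
    case 2
    then show ?thesis
      using eps_KKT_if_short_step[OF \<rho> x' refl r] unfolding w w' by blast
  qed
qed

end

section \<open>Counting iterations\<close>

text \<open>For \<open>N \<ge> 1\<close> the logarithmic factor of every \<open>k \<le> N\<close> is at most \<open>N (ln q + \<delta>)\<close>, and the
  geometric factors sum to at most \<open>\<alpha> \<alpha>\<^sup>N / (\<alpha> - 1)\<close>, where \<open>\<alpha>\<^sup>N \<le> \<alpha> t\<close> and hence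
  \<open>N \<le> log \<alpha> (\<alpha> t)\<close>. This uses a quarter of the constant 8; the rest absorbs the additive 2 of each
  \<open>k\<close>, because \<open>\<alpha>\<^sup>2 / (\<alpha> - 1) \<ge> 4\<close>.\<close>

lemma sum_iterations_le:
  fixes its :: "nat \<Rightarrow> nat" and \<alpha> S q \<delta> t :: real
  assumes \<alpha>: "1 < \<alpha>" and S: "1 \<le> S" and q: "2 \<le> q" and \<delta>: "0 \<le> \<delta>"
    and its: "\<And>k. real (its k) \<le> 2 + 2 * S * \<alpha> ^ k * (ln q + real k * \<delta>)"
    and N: "N = 0 \<or> \<alpha> ^ N \<le> \<alpha> * t"
  shows "int (\<Sum>k\<le>N. its k)
    \<le> \<lceil>8 * \<alpha>\<^sup>2 * S / (\<alpha> - 1) * (ln q + \<delta>)\<rceil> * max 1 \<lceil>t * log \<alpha> (\<alpha> * t)\<rceil>"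
proof -
  define l where "l = ln q + \<delta>"
  define c where "c = \<alpha>\<^sup>2 / (\<alpha> - 1)"
  define A where "A = 8 * \<alpha>\<^sup>2 * S / (\<alpha> - 1) * l"
  have A_eq: "A = 8 * c * (S * l)" by (simp add: A_def c_def)
  have lnq: "2 / 3 \<le> ln q" using ln2_ge_two_thirds q by (smt (verit) ln_le_cancel_iff)
  have l: "2 / 3 \<le> l" "ln q \<le> l" using lnq \<delta> by (auto simp: l_def)
  have Sl: "2 / 3 \<le> S * l" using mult_mono[of 1 S "2 / 3" l] S l by simp
  have "0 \<le> (\<alpha> - 2)\<^sup>2" by simp
  then have "4 * (\<alpha> - 1) \<le> \<alpha>\<^sup>2" by (simp add: power2_eq_square algebra_simps)
  then have "4 \<le> c" using \<alpha> by (simp add: c_def pos_le_divide_eq)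
  then have "8 * 4 * (S * l) \<le> 8 * c * (S * l)"
    using Sl by (intro mult_right_mono) auto
  then have A: "32 * (S * l) \<le> A" by (simp add: A_eq)
  have A0: "0 \<le> A" using A Sl by linarith
  show ?thesis
  proof (cases "N = 0")
    case True
    have "real (its 0) \<le> 2 + 2 * (S * ln q)" using its[of 0] by simp
    moreover have "S * ln q \<le> S * l" using S l by (intro mult_left_mono) auto
    ultimately have "real (its 0) \<le> A" using A Sl by linarith
    then have "int (its 0) \<le> \<lceil>A\<rceil>" by linarith
    also have "\<lceil>A\<rceil> * 1 \<le> \<lceil>A\<rceil> * max 1 \<lceil>t * log \<alpha> (\<alpha> * t)\<rceil>"
      using A0 by (intro mult_left_mono) auto
    finally show ?thesis using True by (simp add: A_def l_def)
  next
    case False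
    then have N1: "1 \<le> N" and \<alpha>N: "\<alpha> ^ N \<le> \<alpha> * t" using N by auto
    have "\<alpha> ^ 1 \<le> \<alpha> ^ N" using \<alpha> N1 by (intro power_increasing) auto
    then have "\<alpha> * 1 \<le> \<alpha> * t" using \<alpha>N by simp
    then have t: "1 \<le> t" using \<alpha> by simp
    have "real N = log \<alpha> (\<alpha> ^ N)" using \<alpha> by (simp add: log_nat_power)
    also have "\<dots> \<le> log \<alpha> (\<alpha> * t)" using \<alpha> \<alpha>N by (intro log_mono) auto
    finally have logN: "real N \<le> log \<alpha> (\<alpha> * t)" .
    have it: "real (its k) \<le> 2 + 2 * (S * l) * real N * \<alpha> ^ k" if k: "k \<le> N" for k
    proof -
      have "ln q + real k * \<delta> \<le> real N * ln q + real N * \<delta>"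
        using N1 k lnq \<delta> by (intro add_mono mult_right_mono) auto
      then have "ln q + real k * \<delta> \<le> real N * l" by (simp add: l_def distrib_left)
      then have "2 * S * \<alpha> ^ k * (ln q + real k * \<delta>) \<le> 2 * S * \<alpha> ^ k * (real N * l)"
        using S \<alpha> by (intro mult_left_mono) auto
      then show ?thesis using its[of k] by (simp add: ac_simps)
    qed
    have "\<alpha> * \<alpha> ^ N \<le> \<alpha> * (\<alpha> * t)" using \<alpha> \<alpha>N by (intro mult_left_mono) auto
    then have \<alpha>SN: "\<alpha> ^ Suc N - 1 \<le> \<alpha>\<^sup>2 * t" by (simp add: power2_eq_square)
    have "(\<Sum>k\<le>N. \<alpha> ^ k) = (\<alpha> ^ Suc N - 1) / (\<alpha> - 1)"
      using geometric_sum[of \<alpha> "Suc N"] \<alpha> by (simp only: lessThan_Suc_atMost)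
    also have "\<dots> \<le> \<alpha>\<^sup>2 * t / (\<alpha> - 1)"
      using \<alpha> \<alpha>SN by (intro divide_right_mono) auto
    finally have geo: "(\<Sum>k\<le>N. \<alpha> ^ k) \<le> c * t" by (simp add: c_def)
    have "real (\<Sum>k\<le>N. its k) \<le> (\<Sum>k\<le>N. 2 + 2 * (S * l) * real N * \<alpha> ^ k)"
      unfolding of_nat_sum by (intro sum_mono it) auto
    also have "\<dots> = 2 * (real N + 1) + 2 * (S * l) * real N * (\<Sum>k\<le>N. \<alpha> ^ k)"
      by (simp add: sum.distrib sum_distrib_left)
    also have "\<dots> \<le> 2 * (real N + 1) + 2 * (S * l) * real N * (c * t)"
      using Sl by (intro add_left_mono mult_left_mono geo) auto
    also have "\<dots> = 2 * (real N + 1) + A * (t * real N) / 4" by (simp add: A_eq)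
    also have "\<dots> \<le> A * (t * real N)"
    proof -
      have "2 * (real N + 1) + v / 4 \<le> v" if "16 * u \<le> v" "real N \<le> u" for u v
        using that of_nat_mono[OF N1, where 'a = real] by simp
      moreover have "1 * real N \<le> t * real N" using t by (intro mult_right_mono) auto
      moreover have "16 * (t * real N) \<le> A * (t * real N)"
        using A Sl t by (intro mult_right_mono) auto
      ultimately show ?thesis by simp
    qed
    also have "\<dots> \<le> A * (t * log \<alpha> (\<alpha> * t))"
      using A0 t logN by (intro mult_left_mono) auto
    also have "\<dots> \<le> real_of_int \<lceil>A\<rceil> * real_of_int (max 1 \<lceil>t * log \<alpha> (\<alpha> * t)\<rceil>)"
    proof (rule mult_mono)
      show "t * log \<alpha> (\<alpha> * t) \<le> real_of_int (max 1 \<lceil>t * log \<alpha> (\<alpha> * t)\<rceil>)" by linarith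
      show "0 \<le> t * log \<alpha> (\<alpha> * t)" using t logN by (intro mult_nonneg_nonneg) auto
    qed (use A0 in auto)
    finally have "real_of_int (int (\<Sum>k\<le>N. its k))
        \<le> real_of_int (\<lceil>A\<rceil> * max 1 \<lceil>t * log \<alpha> (\<alpha> * t)\<rceil>)" by simp
    then show ?thesis unfolding of_int_le_iff A_def l_def .
  qed
qed

section \<open>The complexity bound\<close>

theorem theorem5:
  fixes f P :: "'a::euclidean_space \<Rightarrow> ereal"
    and g :: "'a \<Rightarrow> 'b::euclidean_space"
    and K :: "'b set"
    and \<Omega> :: "'a set"
    and x0 :: 'a and lam0 lam_hat :: 'b
    and xm :: "nat \<Rightarrow> 'a"
    and \<rho> \<eta> :: "nat \<Rightarrow> real"
    and \<epsilon> \<rho>0 \<eta>0 \<alpha> \<beta> \<gamma> Lf LG Lg Mg DX DX_bar D D_bar B_hat C C_hat :: real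
  assumes f: "proper_closed_convex f"
    and P: "proper_closed_convex P"
    and K: "closed K" "convex_cone K"
    and g: "cone_convex K g"
    and dom_P: "compact (edom P)"
    and \<Omega>: "open \<Omega>" "edom P \<subseteq> \<Omega>"
    and f_diff: "\<Omega> \<subseteq> edom f" "\<forall>x\<in>\<Omega>. (\<lambda>y. real_of_ereal (f y)) differentiable (at x)"
      "continuous_on \<Omega> (grad f)" "Lf-lipschitz_on \<Omega> (grad f)"
    and g_diff: "\<forall>x\<in>\<Omega>. g differentiable (at x)"
      "continuous_on \<Omega> (grad_map g)" "LG-lipschitz_on \<Omega> (grad_map g)"
    and strong_duality: "primal_solutions f P g K \<noteq> {}" "dual_solutions f P g K \<noteq> {}"
      "primal_value f P g K = dual_value f P g K"
    and Lg: "Lg-lipschitz_on (edom P) g"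
    and Mg: "Mg = (SUP x\<in>edom P. norm (g x))"
    and init: "x0 \<in> edom P" "lam0 \<in> dual_cone K"
    and lam_hat: "lam_hat \<in> dual_solutions f P g K"
      "norm (lam0 - lam_hat) = infdist lam0 (dual_solutions f P g K)"
    and DX: "DX = diameter (edom P)" "DX_bar = max DX 1"
    and D: "D = infdist x0 (primal_solutions f P g K) + norm (lam0 - lam_hat)" "D_bar = max D 1"
    and B_hat: "B_hat = Lf + LG * norm lam_hat + LG * D"
    and C: "C = LG * Mg + Lg\<^sup>2"
    and xm: "\<forall>k. xm k \<in> edom P"
    and params: "\<epsilon> > 0" "\<rho>0 \<ge> 1" "0 < \<eta>0" "\<eta>0 \<le> 1" "\<alpha> > 1" "0 < \<beta>" "\<beta> < 1"
      "\<gamma> = \<alpha> * \<beta>" "\<gamma> < 1"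
    and \<rho>: "\<rho> = (\<lambda>k. \<rho>0 * \<alpha> ^ k)"
    and \<eta>: "\<eta> = (\<lambda>k. \<eta>0 * \<beta> ^ k)"
    and C_hat: "C_hat = C * \<rho>0 + B_hat + LG * \<rho>0 * \<eta>0 / (1 - \<gamma>) + 1"
  shows "\<exists>N. outer_terminates_at f P g K (sub_L Lf LG Lg Mg) \<rho> \<eta> xm (x0, lam0) \<epsilon> N \<and>
    eps_KKT f P g K \<epsilon> (outer_seq f P g K (sub_L Lf LG Lg Mg) \<rho> \<eta> xm (x0, lam0) (Suc N)) \<and>
    int (\<Sum>k\<le>N. outer_inner_iterations f P g K (sub_L Lf LG Lg Mg) \<rho> \<eta> xm (x0, lam0) k)
      \<le> \<lceil>8 * \<alpha>\<^sup>2 * sqrt (C_hat * \<rho>0) / (\<alpha> - 1) * ln (2 * \<alpha> * C_hat * DX_bar / (\<eta>0 * \<beta>))\<rceil> *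
        max 1 \<lceil>2 * (D_bar + \<rho>0 * \<eta>0) / ((1 - \<gamma>) * \<epsilon>) *
               log \<alpha> (2 * \<alpha> * (D_bar + \<rho>0 * \<eta>0) / ((1 - \<gamma>) * \<epsilon>))\<rceil>"
proof -
  have \<rho>_pos: "0 < \<rho> k" and \<eta>_pos: "0 < \<eta> k" for k
    using params unfolding \<rho> \<eta> by auto
  have DX1: "1 \<le> DX_bar" using DX by simp
  then have DX0: "0 < DX_bar" by simp
  have DXb: "norm (x - y) \<le> DX_bar" if "x \<in> edom P" "y \<in> edom P" for x y
    using diameter_bounded_bound[OF compact_imp_bounded[OF dom_P] that] DX by (simp add: dist_norm)
  interpret run: outer_run f P g K \<Omega> Lf LG Lg Mg \<rho> \<eta> xm "(x0, lam0)" DX_bar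
    by unfold_locales (use assms \<rho>_pos \<eta>_pos DX0 DXb in auto)
  let ?L = "sub_L Lf LG Lg Mg"
  let ?w = "outer_seq f P g K ?L \<rho> \<eta> xm (x0, lam0)"
  let ?test = "outer_test f P g K ?L \<rho> \<eta> xm (x0, lam0) \<epsilon>"
  \<comment> \<open>\<open>E\<close> bounds the accumulated errors \<open>\<rho> i * \<eta> i\<close>. The stopping test holds once the powers of \<open>\<alpha>\<close>
    reach \<open>t\<close>.\<close>
  define E where "E = \<rho>0 * \<eta>0 / (1 - \<gamma>)"
  define t where "t = 2 * (D_bar + \<rho>0 * \<eta>0) / ((1 - \<gamma>) * \<epsilon>)"
  have \<gamma>0: "0 < \<gamma>" using params by simp
  have E0: "0 \<le> E" unfolding E_def using params by simp
  have D_bar0: "0 \<le> D_bar" "D \<le> D_bar" unfolding D(2) by auto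
  have D0: "0 \<le> D" unfolding D by (simp add: infdist_nonneg)

  have errors: "(\<Sum>i<k. \<rho> i * \<eta> i) \<le> E" for k
  proof -
    have "(\<Sum>i<k. \<rho> i * \<eta> i) = \<rho>0 * \<eta>0 * (\<Sum>i<k. \<gamma> ^ i)"
      unfolding \<rho> \<eta> params(8) by (simp add: sum_distrib_left power_mult_distrib ac_simps)
    also have "(\<Sum>i<k. \<gamma> ^ i) = (1 - \<gamma> ^ k) / (1 - \<gamma>)"
      using params(9) by (simp add: sum_gp_strict)
    also have "\<rho>0 * \<eta>0 * ((1 - \<gamma> ^ k) / (1 - \<gamma>)) \<le> \<rho>0 * \<eta>0 * (1 / (1 - \<gamma>))"
      using params \<gamma>0 by (intro mult_left_mono divide_right_mono) auto
    finally show ?thesis by (simp add: E_def)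
  qed
  \<comment> \<open>The distance to the primal solutions is only an infimum, so the bounds for the single
    solutions are combined here.\<close>
  have infimum: "c \<le> D + E"
    if bound: "\<And>xs. xs \<in> primal_solutions f P g K \<Longrightarrow> c \<le> norm ((x0, lam0) - (xs, lam_hat)) + E" for c
  proof -
    have "c - norm (lam0 - lam_hat) - E \<le> dist x0 xs" if xs: "xs \<in> primal_solutions f P g K" for xs
      using bound[OF xs] norm_Pair_le[of "x0 - xs" "lam0 - lam_hat"] by (simp add: dist_norm)
    then have "c - norm (lam0 - lam_hat) - E \<le> infdist x0 (primal_solutions f P g K)"
      unfolding infdist_notempty[OF strong_duality(1)] by (intro cINF_greatest strong_duality(1))
    then show ?thesis unfolding D by simp
  qed
  note saddle = run.saddle_point[OF _ lam_hat(1) strong_duality(3)]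
  have multiplier: "norm (snd (?w k)) \<le> norm lam_hat + D + E" for k
  proof -
    have "norm (snd (?w k) - lam_hat) \<le> D + E"
    proof (rule infimum)
      fix xs assume xs: "xs \<in> primal_solutions f P g K"
      have "norm (snd (?w k) - lam_hat) \<le> norm (?w k - (xs, lam_hat))"
        using norm_snd_le[of "snd (?w k) - lam_hat" "fst (?w k) - xs"] by (cases "?w k") simp
      also have "\<dots> \<le> norm ((x0, lam0) - (xs, lam_hat)) + (\<Sum>i<k. \<rho> i * \<eta> i)"
        by (rule run.outer_distances(1)[OF saddle[OF xs]])
      finally show "norm (snd (?w k) - lam_hat) \<le> norm ((x0, lam0) - (xs, lam_hat)) + E"
        using errors[of k] by simp
    qed
    then show ?thesis using norm_triangle_sub[of "snd (?w k)" lam_hat] by simp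
  qed
  have displacement: "norm (?w (Suc k) - ?w k) \<le> D + E" for k
  proof (rule infimum)
    fix xs assume xs: "xs \<in> primal_solutions f P g K"
    show "norm (?w (Suc k) - ?w k) \<le> norm ((x0, lam0) - (xs, lam_hat)) + E"
      using run.outer_distances(2)[OF saddle[OF xs], of k] errors[of "Suc k"] by linarith
  qed

  have "2 * b / (c * \<epsilon>) * \<epsilon> / 2 = b / c" for b c using params(1) by simp
  then have "t * \<epsilon> / 2 = (D_bar + \<rho>0 * \<eta>0) / (1 - \<gamma>)" unfolding t_def .
  moreover have "D_bar \<le> D_bar / (1 - \<gamma>)"
    using D_bar0 params(9) \<gamma>0 by (simp add: pos_le_divide_eq mult_left_le)
  ultimately have tDE: "D_bar + E \<le> t * \<epsilon> / 2"
    unfolding E_def add_divide_distrib by linarith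
  have "\<rho>0 * \<eta>0 * 1 \<le> \<rho>0 * \<eta>0 * (1 / (1 - \<gamma>))"
    using params \<gamma>0 by (intro mult_left_mono) (auto simp: pos_le_divide_eq)
  then have "\<rho>0 * \<eta>0 \<le> E" by (simp add: E_def)
  moreover have "1 * \<eta>0 \<le> \<rho>0 * \<eta>0" using params by (intro mult_right_mono) auto
  ultimately have t\<eta>: "\<eta>0 \<le> t * \<epsilon> / 2" using tDE D_bar0 by linarith

  \<comment> \<open>The tolerance decays faster than the powers of \<open>\<alpha>\<close> grow, as \<open>\<gamma> < 1\<close>.\<close>
  have test: "?test k" if k: "t \<le> \<alpha> ^ k" for k
  proof -
    have \<alpha>k: "0 < \<alpha> ^ k" using params by simp
    have "t * \<epsilon> / 2 \<le> \<alpha> ^ k * \<epsilon> / 2" using k params by simp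
    also have "\<dots> \<le> \<rho> k * \<epsilon> / 2" unfolding \<rho> using params by simp
    finally have "norm (?w (Suc k) - ?w k) \<le> \<rho> k * (\<epsilon> / 2)"
      using displacement[of k] tDE D_bar0 by linarith
    then have "1 / \<rho> k * norm (?w (Suc k) - ?w k) \<le> \<epsilon> / 2"
      using \<rho>_pos[of k] by (simp add: pos_divide_le_eq mult.commute)
    moreover have "\<eta> k \<le> \<epsilon> / 2"
    proof -
      have "\<eta> k * \<alpha> ^ k = \<eta>0 * \<gamma> ^ k"
        unfolding \<eta> params(8) by (simp add: power_mult_distrib ac_simps)
      also have "\<dots> \<le> \<eta>0" using params \<gamma>0 by (simp add: power_le_one mult_left_le)
      also have "\<dots> \<le> \<alpha> ^ k * \<epsilon> / 2"
        using t\<eta> \<open>t * \<epsilon> / 2 \<le> \<alpha> ^ k * \<epsilon> / 2\<close> by linarith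
      finally have "\<eta> k * \<alpha> ^ k \<le> \<epsilon> / 2 * \<alpha> ^ k" by (simp add: mult.commute)
      then show ?thesis using \<alpha>k by (rule mult_right_le_imp_le)
    qed
    ultimately show ?thesis unfolding outer_test_def Let_def by blast
  qed
  obtain n0 where "t < \<alpha> ^ n0" using real_arch_pow[of \<alpha> t] params by blast
  define N where "N = (LEAST k. ?test k)"
  have N_test: "?test N" unfolding N_def
    using test[of n0] \<open>t < \<alpha> ^ n0\<close> by (intro LeastI[of ?test n0]) simp
  have N_min: "\<not> ?test k" if "k < N" for k using not_less_Least that N_def by blast
  \<comment> \<open>If \<open>N > 0\<close>, the test fails at \<open>N - 1\<close>, so the power of \<open>\<alpha>\<close> there is below \<open>t\<close>.\<close>
  have N_le: "N = 0 \<or> \<alpha> ^ N \<le> \<alpha> * t"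
  proof (cases N)
    case (Suc m)
    then have "\<not> t \<le> \<alpha> ^ m" using N_min[of m] test[of m] by auto
    then show ?thesis using params Suc by simp
  qed simp

  let ?q = "2 * C_hat * DX_bar / \<eta>0"
  have Cnn: "0 \<le> C" and Bnn: "0 \<le> B_hat"
    unfolding C B_hat using run.constants_nonneg run.Mg_nonneg D0 by auto
  have LGE: "LG * \<rho>0 * \<eta>0 / (1 - \<gamma>) = LG * E" by (simp add: E_def)
  have Ch: "1 \<le> C_hat"
    unfolding C_hat LGE using Cnn Bnn E0 run.constants_nonneg params by simp
  have S1: "1 \<le> sqrt (C_hat * \<rho>0)"
    using mult_mono[of 1 C_hat 1 \<rho>0] Ch params by simp
  have CD: "1 \<le> C_hat * DX_bar" using mult_mono[of 1 C_hat 1 DX_bar] Ch DX1 by simp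
  have q2: "2 \<le> ?q"
    using CD params by (simp add: pos_le_divide_eq)
  have "1 \<le> \<alpha> / \<beta>" using params by (simp add: pos_le_divide_eq)
  then have \<delta>0: "0 \<le> ln (\<alpha> / \<beta>)" by simp

  \<comment> \<open>Besides \<open>\<rho> k\<close>, only the multiplier enters the Lipschitz constant, and it stays bounded.\<close>
  have L_le: "?L (snd (?w k)) (\<rho> k) \<le> C_hat * \<alpha> ^ k" for k
  proof -
    have \<alpha>k: "1 \<le> \<alpha> ^ k" using params by simp
    have "Lf + LG * norm (snd (?w k)) \<le> Lf + LG * (norm lam_hat + D + E)"
      using multiplier[of k] run.constants_nonneg by (intro add_left_mono mult_left_mono) auto
    also have "\<dots> = (B_hat + LG * E) * 1" by (simp add: B_hat distrib_left)
    also have "\<dots> \<le> (B_hat + LG * E) * \<alpha> ^ k"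
      using Bnn E0 run.constants_nonneg \<alpha>k by (intro mult_left_mono) auto
    finally have 1: "Lf + LG * norm (snd (?w k)) \<le> (B_hat + LG * E) * \<alpha> ^ k" .
    have "1 * 1 \<le> \<rho>0 * \<alpha> ^ k" using params \<alpha>k by (intro mult_mono) auto
    then have "1 / \<rho> k \<le> 1" unfolding \<rho> by simp
    then have 2: "1 / \<rho> k \<le> \<alpha> ^ k" using \<alpha>k by linarith
    have "?L (snd (?w k)) (\<rho> k) = (Lf + LG * norm (snd (?w k))) + C * \<rho>0 * \<alpha> ^ k + 1 / \<rho> k"
      unfolding sub_L_def C \<rho> by (simp add: algebra_simps)
    also have "\<dots> \<le> (B_hat + LG * E) * \<alpha> ^ k + C * \<rho>0 * \<alpha> ^ k + \<alpha> ^ k"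
      using 1 2 by linarith
    also have "\<dots> = C_hat * \<alpha> ^ k" unfolding C_hat LGE by (simp add: algebra_simps)
    finally show ?thesis .
  qed
  have L_pos: "0 < ?L l (\<rho> k)" for l :: 'b and k
    using run.sub_L_ge[OF \<rho>_pos, of k l] \<rho>_pos[of k] by (meson less_le_trans zero_less_divide_1_iff)

  have its: "real (outer_inner_iterations f P g K ?L \<rho> \<eta> xm (x0, lam0) k)
      \<le> 2 + 2 * sqrt (C_hat * \<rho>0) * \<alpha> ^ k * (ln ?q + real k * ln (\<alpha> / \<beta>))" for k
  proof -
    let ?Lk = "?L (snd (?w k)) (\<rho> k)"
    have \<alpha>k: "0 < \<alpha> ^ k" using params by simp
    have "?Lk * \<rho> k \<le> C_hat * \<alpha> ^ k * \<rho> k"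
      using L_le[of k] \<rho>_pos[of k] by (intro mult_right_mono) auto
    also have "\<dots> = C_hat * \<rho>0 * (\<alpha> ^ k)\<^sup>2"
      unfolding \<rho> by (simp add: power2_eq_square)
    finally have "sqrt (?Lk * \<rho> k) \<le> sqrt (C_hat * \<rho>0 * (\<alpha> ^ k)\<^sup>2)"
      by (rule real_sqrt_le_mono)
    also have "\<dots> = sqrt (C_hat * \<rho>0) * \<alpha> ^ k"
      using \<alpha>k by (simp add: real_sqrt_mult)
    finally have sq: "sqrt (?Lk * \<rho> k) \<le> sqrt (C_hat * \<rho>0) * \<alpha> ^ k" .
    have "2 * ?Lk * DX_bar / \<eta> k \<le> 2 * (C_hat * \<alpha> ^ k) * DX_bar / \<eta> k"
      using L_le[of k] DX0 \<eta>_pos[of k] by (intro divide_right_mono mult_right_mono) auto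
    also have "\<dots> = ?q * (\<alpha> / \<beta>) ^ k" unfolding \<eta> by (simp add: power_divide)
    finally have "ln (2 * ?Lk * DX_bar / \<eta> k) \<le> ln (?q * (\<alpha> / \<beta>) ^ k)"
      using L_pos[of "snd (?w k)" k] DX0 \<eta>_pos[of k] by (intro ln_mono) auto
    also have "\<dots> = ln ?q + real k * ln (\<alpha> / \<beta>)"
      using q2 params by (subst ln_mult) (auto simp: ln_realpow)
    finally have lg: "ln (2 * ?Lk * DX_bar / \<eta> k) \<le> ln ?q + real k * ln (\<alpha> / \<beta>)" .
    have lg0: "0 \<le> ln ?q + real k * ln (\<alpha> / \<beta>)"
      using q2 \<delta>0 by (intro add_nonneg_nonneg mult_nonneg_nonneg) auto
    have "2 * sqrt (?Lk * \<rho> k) * ln (2 * ?Lk * DX_bar / \<eta> k)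
        \<le> 2 * sqrt (?Lk * \<rho> k) * (ln ?q + real k * ln (\<alpha> / \<beta>))"
      using lg L_pos[of "snd (?w k)" k] \<rho>_pos[of k] by (intro mult_left_mono) auto
    also have "\<dots> \<le> 2 * (sqrt (C_hat * \<rho>0) * \<alpha> ^ k) * (ln ?q + real k * ln (\<alpha> / \<beta>))"
      using sq lg0 by (intro mult_right_mono) auto
    finally have "max 0 (2 * sqrt (?Lk * \<rho> k) * ln (2 * ?Lk * DX_bar / \<eta> k))
        \<le> 2 * sqrt (C_hat * \<rho>0) * \<alpha> ^ k * (ln ?q + real k * ln (\<alpha> / \<beta>))"
      using lg0 S1 \<alpha>k by simp
    then show ?thesis
      using run.outer_step(2)[of k] by linarith
  qed
  have "ln ?q + ln (\<alpha> / \<beta>) = ln (?q * (\<alpha> / \<beta>))"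
    using q2 params by (subst ln_mult) auto
  also have "?q * (\<alpha> / \<beta>) = 2 * \<alpha> * C_hat * DX_bar / (\<eta>0 * \<beta>)" by simp
  finally have ln_eq: "ln ?q + ln (\<alpha> / \<beta>) = ln (2 * \<alpha> * C_hat * DX_bar / (\<eta>0 * \<beta>))" .
  have t_eq: "\<alpha> * t = 2 * \<alpha> * (D_bar + \<rho>0 * \<eta>0) / ((1 - \<gamma>) * \<epsilon>)"
    by (simp add: t_def)
  note total = sum_iterations_le[OF params(5) S1 q2 \<delta>0 its N_le]
  have "outer_terminates_at f P g K ?L \<rho> \<eta> xm (x0, lam0) \<epsilon> N"
    unfolding outer_terminates_at_def
    using run.outer_step(1) N_test N_min by blast
  moreover have "eps_KKT f P g K \<epsilon> (?w (Suc N))"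
    by (rule run.eps_KKT_if_outer_test[OF N_test])
  ultimately show ?thesis
    using total unfolding ln_eq t_eq unfolding t_def by blast
qed

end
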